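(* Let $t=(\eta(2\tau)/\eta(\tau))^{24}$, $H=\eta(\tau)^4/\eta(2\tau)^2$, $J=2E_2(2\tau)-E_2(\tau)$, $u=64t$ and $\mathcal T=H^4J$, all regarded as power series in $q$ with integer coefficients. Then one has the inclusion of $\mathbf Z_2$-modules $$U_2\bigl(\mathcal T\,t\,\mathbf Z_2[[u]]\bigr)\subseteq 2^5\,\mathcal T\,t\,\mathbf Z_2[[u]].$$ Consequently, if $f(z)\in\mathbf Z_2[[z]]$ and $\mathcal F_f=\mathcal T\,t\,f(u)=\sum_{n\ge1}a_f(n)q^n$, then $$v_2\bigl(a_f(2^rm)\bigr)\ge 5r\qquad\text{for all integers } m,r\ge1.$$
   Context: $q=e^{2\pi i\tau}$; $\eta(\tau)=q^{1/24}\prod_{n\ge1}(1-q^n)$; $E_2=1-24\sum_{n\ge1}\sigma_1(n)q^n$. Thus $t=q\prod_{n\ge1}(1+q^n)^{24}$. $\mathbf Z_2$ is the ring of $2$-adic integers and $v_2$ the $2$-adic valuation. $\mathcal T\,t\,\mathbf Z_2[[u]]$ denotes the set $\{\mathcal T\,t\,f(u): f(z)\in\mathbf Z_2[[z]]\}\subset q\,\mathbf Z_2[[q]]$, where $f(u)$ is obtained by substituting the $q$-series $u\in q\mathbf Z[[q]]$. The operator $U_2$ acts on power series by $U_2\bigl(\sum_n a(n)q^n\bigr)=\sum_n a(2n)q^n$. *)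

theory Defs
  imports
    "HOL-Computational_Algebra.Formal_Power_Series"
    "HOL-Analysis.Infinite_Products"
    "HOL-Library.Extended_Nat"
begin

unbundle no vec_syntax
unbundle fps_syntax

text \<open>
  \<open>\<int>\<^sub>2\<close> is the inverse limit of the rings \<open>\<int>/2\<^sup>n\<int>\<close>: an element is a sequence of compatible
  residues, the \<open>n\<close>-th one represented by an integer in \<open>{0..<2\<^sup>n}\<close>.
\<close>

typedef Z2 = "{x :: nat \<Rightarrow> int. \<forall>n. 0 \<le> x n \<and> x n < 2 ^ n \<and> x (Suc n) mod 2 ^ n = x n}"
  morphisms residue_Z2 Abs_Z2
  by (rule exI[of _ "\<lambda>_. 0"]) simp

setup_lifting type_definition_Z2

lemma mod_pow2_compat: "(a mod 2 ^ Suc n) mod 2 ^ n = a mod (2 ^ n :: int)"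
  by (simp add: mod_mod_cancel)

lemma residue_Z2_mod: "residue_Z2 x n mod 2 ^ n = residue_Z2 x n"
  using residue_Z2[of x] by auto

lemma residue_Z2_0 [simp]: "residue_Z2 x 0 = 0"
  using residue_Z2[of x] by (auto dest!: spec[of _ 0])

lemma Z2_eqI: "(\<And>n. residue_Z2 x n = residue_Z2 y n) \<Longrightarrow> x = y"
  by transfer auto

instantiation Z2 :: comm_ring_1
begin

lift_definition zero_Z2 :: Z2 is "\<lambda>n. 0" by simp

lift_definition one_Z2 :: Z2 is "\<lambda>n. 1 mod 2 ^ n"
  by (auto simp: mod_pow2_compat simp del: power_Suc)

lift_definition plus_Z2 :: "Z2 \<Rightarrow> Z2 \<Rightarrow> Z2" is "\<lambda>x y n. (x n + y n) mod 2 ^ n"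
  by (simp add: mod_pow2_compat del: power_Suc) (metis mod_add_eq)

lift_definition times_Z2 :: "Z2 \<Rightarrow> Z2 \<Rightarrow> Z2" is "\<lambda>x y n. (x n * y n) mod 2 ^ n"
  by (simp add: mod_pow2_compat del: power_Suc) (metis mod_mult_eq)

lift_definition uminus_Z2 :: "Z2 \<Rightarrow> Z2" is "\<lambda>x n. (- x n) mod 2 ^ n"
  by (simp add: mod_pow2_compat del: power_Suc) (metis mod_minus_eq)

lift_definition minus_Z2 :: "Z2 \<Rightarrow> Z2 \<Rightarrow> Z2" is "\<lambda>x y n. (x n - y n) mod 2 ^ n"
  by (simp add: mod_pow2_compat del: power_Suc) (metis mod_diff_eq)

instance
proof
  fix a b c :: Z2
  show "a * b * c = a * (b * c)"
    by (rule Z2_eqI) (simp add: times_Z2.rep_eq mod_simps mult.assoc)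
  show "a * b = b * a"
    by (rule Z2_eqI) (simp add: times_Z2.rep_eq mult.commute)
  show "1 * a = a"
    by (rule Z2_eqI) (simp add: times_Z2.rep_eq one_Z2.rep_eq mod_simps residue_Z2_mod)
  show "a + b + c = a + (b + c)"
    by (rule Z2_eqI) (simp add: plus_Z2.rep_eq mod_simps add.assoc)
  show "a + b = b + a"
    by (rule Z2_eqI) (simp add: plus_Z2.rep_eq add.commute)
  show "0 + a = a"
    by (rule Z2_eqI) (simp add: plus_Z2.rep_eq zero_Z2.rep_eq residue_Z2_mod)
  show "- a + a = 0"
    by (rule Z2_eqI) (simp add: plus_Z2.rep_eq uminus_Z2.rep_eq zero_Z2.rep_eq mod_simps)
  show "a - b = a + - b"
    by (rule Z2_eqI) (simp add: plus_Z2.rep_eq uminus_Z2.rep_eq minus_Z2.rep_eq mod_simps)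
  show "(a + b) * c = a * c + b * c"
    by (rule Z2_eqI) (simp add: plus_Z2.rep_eq times_Z2.rep_eq mod_simps distrib_right)
  have "residue_Z2 0 1 \<noteq> residue_Z2 1 1"
    by (simp add: zero_Z2.rep_eq one_Z2.rep_eq)
  thus "(0::Z2) \<noteq> 1" by metis
qed

end

lemma residue_Z2_of_nat: "residue_Z2 (of_nat k) n = int k mod 2 ^ n"
  by (induction k) (simp_all add: zero_Z2.rep_eq plus_Z2.rep_eq one_Z2.rep_eq mod_simps)

lemma residue_Z2_of_int: "residue_Z2 (of_int k) n = k mod 2 ^ n"
  by (cases k rule: int_cases2)
     (simp_all add: residue_Z2_of_nat uminus_Z2.rep_eq mod_simps)

text \<open>The 2-adic valuation; \<open>v2 0 = \<infinity>\<close>.\<close>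

definition v2 :: "Z2 \<Rightarrow> enat" where
  "v2 x = (SUP k \<in> {k. 2 ^ k dvd x}. enat k)"

definition fps_of_ints :: "int fps \<Rightarrow> 'a :: ring_1 fps" where
  "fps_of_ints f = Abs_fps (\<lambda>n. of_int (f $ n))"

definition U2 :: "'a fps \<Rightarrow> 'a fps" where
  "U2 f = Abs_fps (\<lambda>n. f $ (2 * n))"

text \<open>
  Because of the factor \<open>q\<^bsup>1/24\<^esup>\<close>, the series of \<open>\<eta>\<close> is a power series in \<open>x = q\<^bsup>1/24\<^esup>\<close>, namely
  \<open>x \<Prod>\<^sub>n (1 - x\<^bsup>24n\<^esup>)\<close>. Passing from \<open>\<tau>\<close> to \<open>2\<tau>\<close> is the substitution of \<open>x\<^sup>2\<close> for \<open>x\<close>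
  (and of \<open>q\<^sup>2\<close> for \<open>q\<close>). The product converges in the \<open>x\<close>-adic topology. Rational
  coefficients are used so that quotients are available.
\<close>

definition eta :: "rat fps" where
  "eta = fps_X * prodinf (\<lambda>n. 1 - fps_X ^ (24 * Suc n))"

text \<open>
  \<open>in_x f\<close> is the series \<open>f(q)\<close> rewritten in the variable \<open>x\<close>, where \<open>q = x\<^sup>2\<^sup>4\<close>.
\<close>

definition in_x :: "int fps \<Rightarrow> rat fps" where
  "in_x f = fps_of_ints f oo fps_X ^ 24"

definition E2 :: "int fps" where
  "E2 = 1 - 24 * Abs_fps (\<lambda>n. if n = 0 then 0 else \<Sum>d | d dvd n. int d)"

text \<open>
  The set \<open>{A f(u) : f \<in> \<int>\<^sub>2[[z]]}\<close>. The substitution is meaningful when \<open>u\<close> has constant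
  coefficient \<open>0\<close>.
\<close>

definition Z2_span :: "int fps \<Rightarrow> int fps \<Rightarrow> Z2 fps set" where
  "Z2_span A u = range (\<lambda>f :: Z2 fps. fps_of_ints A * (f oo fps_of_ints u))"

lemma subspace_Z2_span:
  "module.subspace (\<lambda>(c :: Z2) g. fps_const c * g) (Z2_span A u)"
proof -
  interpret module "\<lambda>(c :: Z2) g. fps_const c * g"
    by standard (simp_all add: algebra_simps flip: fps_const_add fps_const_mult)
  show ?thesis
    unfolding Z2_span_def
  proof (rule subspaceI)
    show "0 \<in> range (\<lambda>f :: Z2 fps. fps_of_ints A * (f oo fps_of_ints u))"
      by (rule range_eqI[of _ _ 0]) simp
  next
    fix g h :: "Z2 fps"
    assume "g \<in> range (\<lambda>f. fps_of_ints A * (f oo fps_of_ints u))"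
       and "h \<in> range (\<lambda>f. fps_of_ints A * (f oo fps_of_ints u))"
    then obtain f1 f2 where "g = fps_of_ints A * (f1 oo fps_of_ints u)"
        "h = fps_of_ints A * (f2 oo fps_of_ints u)" by blast
    thus "g + h \<in> range (\<lambda>f. fps_of_ints A * (f oo fps_of_ints u))"
      by (intro range_eqI[of _ _ "f1 + f2"])
         (simp add: fps_compose_add_distrib algebra_simps)
  next
    fix c and g :: "Z2 fps"
    assume "g \<in> range (\<lambda>f. fps_of_ints A * (f oo fps_of_ints u))"
    then obtain f where g: "g = fps_of_ints A * (f oo fps_of_ints u)" by blast
    have "fps_const c * f oo fps_of_ints u = fps_const c * (f oo fps_of_ints u)"
      by (rule fps_ext) (simp add: fps_compose_nth sum_distrib_left mult.assoc)
    thus "fps_const c * g \<in> range (\<lambda>f. fps_of_ints A * (f oo fps_of_ints u))"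
      by (intro range_eqI[of _ _ "fps_const c * f"]) (simp add: g mult_ac)
  qed
qed

end

theory Submission
  imports Defs
begin

text \<open>
  Write \<open>\<phi>(q) = \<Sum> q\<^bsup>j^2\<^esup>\<close> and \<open>x = \<phi>(-q)\<^sup>4 / \<phi>(q)\<^sup>4\<close>. Replacing \<open>q\<close> by \<open>-q\<close> turns \<open>x\<close> into \<open>1/x\<close>, and
  \<open>16 t x\<^sup>2 = 1 - x\<close>, \<open>256 x t(q\<^sup>2) = (1 - x)\<^sup>2\<close>, \<open>H\<^sup>4 = x H(q\<^sup>2)\<^sup>4\<close>. Eliminating \<open>x\<close> gives a quadratic
  equation for \<open>t\<close> over \<open>\<int>[t(q\<^sup>2)]\<close>. Logarithmic differentiation of the product for \<open>t\<close> gives \<open>J t = q dt/dq\<close>,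
  so differentiating the relations expresses \<open>\<W> = \<T> t = H\<^sup>4 q dt/dq\<close> through \<open>x\<close> and \<open>\<W>(q\<^sup>2)\<close>. Since
  \<open>U\<^sub>2\<close> extracts the even part, \<open>U\<^sub>2 \<W> = 32 \<W>\<close> and \<open>U\<^sub>2 (\<W> u) = 64 (1 + 20 u + 32 u\<^sup>2) \<W>\<close>, and the
  quadratic equation, \<open>u\<^sup>2 = (48 u(q\<^sup>2) + 64 u(q\<^sup>2)\<^sup>2) u + 64 u(q\<^sup>2)\<close>, gives \<open>U\<^sub>2 (\<W> u\<^sup>n)\<close> for all \<open>n\<close> by recursion.
\<close>

section \<open>Infinite products of power series\<close>

text \<open>Convergence of power series means that each coefficient is eventually constant, and
  coefficient \<open>n\<close> of a product involves only coefficients up to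
  \<open>n\<close>.\<close>

lemma tendsto_fps_mult:
  fixes a b :: "'a::comm_ring_1 fps"
  assumes "(f \<longlongrightarrow> a) F" "(g \<longlongrightarrow> b) F"
  shows "((\<lambda>x. f x * g x) \<longlongrightarrow> a * b) F"
proof (rule tendsto_fpsI)
  fix n
  have "\<forall>\<^sub>F x in F. \<forall>k\<in>{..n}. f x $ k = a $ k \<and> g x $ k = b $ k"
    using assms by (subst eventually_ball_finite_distrib)
      (auto simp: tendsto_fps_iff intro!: eventually_conj)
  then show "\<forall>\<^sub>F x in F. (f x * g x) $ n = (a * b) $ n"
    by eventually_elim (auto simp: fps_mult_nth intro!: sum.cong)
qed

lemma tendsto_fps_compose_left:
  fixes a :: "'a::comm_ring_1 fps"
  assumes "(f \<longlongrightarrow> a) F"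
  shows "((\<lambda>x. f x oo h) \<longlongrightarrow> a oo h) F"
proof (rule tendsto_fpsI)
  fix n
  have "\<forall>\<^sub>F x in F. \<forall>k\<in>{..n}. f x $ k = a $ k"
    using assms by (subst eventually_ball_finite_distrib) (auto simp: tendsto_fps_iff)
  then show "\<forall>\<^sub>F x in F. (f x oo h) $ n = (a oo h) $ n"
    by eventually_elim (auto simp: fps_compose_nth intro!: sum.cong)
qed

lemma tendsto_fps_XD:
  fixes a :: "'a::comm_ring_1 fps"
  assumes "(f \<longlongrightarrow> a) F"
  shows "((\<lambda>x. fps_XD (f x)) \<longlongrightarrow> fps_XD a) F"
proof (rule tendsto_fpsI)
  fix n
  have "\<forall>\<^sub>F x in F. f x $ n = a $ n"
    using assms by (simp add: tendsto_fps_iff)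
  then show "\<forall>\<^sub>F x in F. fps_XD (f x) $ n = fps_XD a $ n"
    by eventually_elim simp
qed

lemma fps_XD_mult: "fps_XD (a * b) = fps_XD a * b + a * fps_XD (b :: 'a::comm_ring_1 fps)"
  by (simp add: fps_XD_def algebra_simps)

lemma fps_XD_power:
  "fps_XD (a ^ n) = of_nat n * a ^ (n - 1) * fps_XD (a :: 'a::comm_ring_1 fps)"
proof (induction n)
  case (Suc n)
  then show ?case by (cases n) (simp_all add: fps_XD_mult algebra_simps)
qed (simp add: fps_XD_def)

lemma fps_nth_compose_X_power:
  fixes f :: "'a::comm_ring_1 fps"
  assumes "k > 0"
  shows "(f oo fps_X ^ k) $ n = (if k dvd n then f $ (n div k) else 0)"
proof -
  have "(f oo fps_X ^ k) $ n = (\<Sum>i=0..n. if n = k * i then f $ i else 0)"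
    by (simp add: fps_compose_nth mult_delta_right flip: power_mult cong: if_cong)
  also have "\<dots> = (\<Sum>i=0..n. if i = n div k then (if k dvd n then f $ i else 0) else 0)"
    using assms by (intro sum.cong refl) (auto split: if_splits)
  also have "\<dots> = (if k dvd n then f $ (n div k) else 0)"
    by (subst sum.delta) auto
  finally show ?thesis .
qed

lemma fps_compose_X_power_inj:
  fixes f g :: "'a::comm_ring_1 fps"
  assumes "f oo fps_X ^ k = g oo fps_X ^ k" "k > 0"
  shows "f = g"
proof (rule fps_ext)
  fix n
  have "(f oo fps_X ^ k) $ (k * n) = (g oo fps_X ^ k) $ (k * n)"
    by (simp only: assms(1))
  then show "f $ n = g $ n"
    using assms(2) by (simp add: fps_nth_compose_X_power)
qed

lemma fps_XD_compose_X_power: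
  fixes a :: "'a::comm_ring_1 fps"
  assumes "k > 0"
  shows "fps_XD (a oo fps_X ^ k) = of_nat k * (fps_XD a oo fps_X ^ k)"
proof (rule fps_ext)
  fix n
  have "(of_nat k * (fps_XD a oo fps_X ^ k)) $ n = of_nat k * (fps_XD a oo fps_X ^ k) $ n"
    by (simp flip: fps_of_nat)
  then show "fps_XD (a oo fps_X ^ k) $ n = (of_nat k * (fps_XD a oo fps_X ^ k)) $ n"
    using assms by (auto simp: fps_nth_compose_X_power elim!: dvdE)
qed

text \<open>Adding the transform under q -> -q cancels the odd coefficients and doubles the even
  ones. An identity for \<open>U2\<close> thus becomes one between a series and its value at
  -q.\<close>

lemma fps_even_part:
  fixes f :: "'a::comm_ring_1 fps"
  shows "f + (f oo - fps_X) = 2 * (U2 f oo fps_X ^ 2)"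
proof (rule fps_ext)
  fix n
  have "(2 * (U2 f oo fps_X ^ 2)) $ n = 2 * (U2 f oo fps_X ^ 2) $ n"
    by (simp only: mult_2 fps_add_nth)
  then show "(f + (f oo - fps_X)) $ n = (2 * (U2 f oo fps_X ^ 2)) $ n"
    by (cases "even n") (auto simp: fps_compose_uminus' fps_nth_compose_X_power U2_def)
qed

text \<open>Coefficient \<open>n\<close> of the infinite product is read off from the factors with
  \<open>k \<le> n\<close>. This is the right value when \<open>d k > k\<close>, since every later
  factor is then 1 modulo q^(n+1).\<close>

definition qprod :: "(nat \<Rightarrow> nat) \<Rightarrow> rat fps" where
  "qprod d = Abs_fps (\<lambda>n. (\<Prod>k\<le>n. 1 - fps_X ^ d k) $ n)"

lemma qprod_tendsto:
  assumes "\<And>k. d k > k"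
  shows "(\<lambda>N. \<Prod>k<N. 1 - fps_X ^ d k) \<longlonglongrightarrow> qprod d"
proof (rule tendsto_fpsI)
  fix n
  have "(\<Prod>k<N. 1 - fps_X ^ d k :: rat fps) $ n = qprod d $ n" if "N \<ge> Suc n" for N
    using that
  proof (induction N rule: dec_induct)
    case base
    show ?case by (simp add: qprod_def lessThan_Suc_atMost)
  next
    case (step N)
    have "n < d N" using assms[of N] step by simp
    then show ?case using step
      by (simp add: algebra_simps fps_X_power_mult_nth)
  qed
  then show "\<forall>\<^sub>F N in sequentially. (\<Prod>k<N. 1 - fps_X ^ d k :: rat fps) $ n = qprod d $ n"
    unfolding eventually_sequentially by blast
qed

lemma qprod_0:
  assumes "\<And>k. d k > k"
  shows "qprod d $ 0 = 1"
  using assms[of 0] by (simp add: qprod_def)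

lemma qprod_compose:
  assumes "\<And>k. d k > k" "m > 0"
  shows "qprod d oo fps_X ^ m = qprod (\<lambda>k. m * d k)"
proof -
  have *: "m * d k > k" for k
    using assms(2) by (intro less_le_trans[OF assms(1)]) simp
  have "(\<lambda>N. (\<Prod>k<N. 1 - fps_X ^ d k) oo fps_X ^ m) \<longlonglongrightarrow> (qprod d oo fps_X ^ m)"
    by (intro tendsto_fps_compose_left qprod_tendsto assms)
  moreover have "(\<Prod>k<N. 1 - fps_X ^ d k) oo fps_X ^ m = (\<Prod>k<N. 1 - fps_X ^ (m * d k) :: rat fps)" for N
  proof -
    have "(1 - fps_X ^ d k) oo fps_X ^ m = (1 - fps_X ^ (m * d k) :: rat fps)" for k
      using assms(2) by (simp only: fps_compose_sub_distrib fps_compose_1 power_mult)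
        (subst fps_X_power_compose, simp_all)
    then show ?thesis
      using assms(2) by (subst fps_compose_prod_distrib) simp_all
  qed
  ultimately have "(\<lambda>N. \<Prod>k<N. 1 - fps_X ^ (m * d k)) \<longlonglongrightarrow> (qprod d oo fps_X ^ m)"
    by simp
  then show ?thesis
    using qprod_tendsto[OF *] by (rule LIMSEQ_unique)
qed

section \<open>Euler's product and its behaviour under q -> q^2 and q -> -q\<close>

definition euler :: "rat fps" where "euler = qprod Suc"

definition odd_prod :: "rat fps" where "odd_prod = qprod (\<lambda>k. 2 * k + 1)"

lemma euler_tendsto: "(\<lambda>N. \<Prod>k<N. 1 - fps_X ^ Suc k) \<longlonglongrightarrow> euler"
  unfolding euler_def by (rule qprod_tendsto) simp

lemma euler_0 [simp]: "euler $ 0 = 1"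
  unfolding euler_def by (rule qprod_0) simp

lemma prodinf_eq_euler: "prodinf (\<lambda>n. 1 - fps_X ^ (24 * Suc n)) = euler oo fps_X ^ 24"
proof -
  have eq: "euler oo fps_X ^ 24 = qprod (\<lambda>n. 24 * Suc n)"
    unfolding euler_def by (rule qprod_compose) auto
  \<comment> \<open>\<open>has_prod\<close> is phrased with products over \<open>{..n}\<close> and a
    nonzero limit, hence the index shift here and the look at the constant term below.\<close>
  have "(\<lambda>N. \<Prod>k<Suc N. 1 - fps_X ^ (24 * Suc k)) \<longlonglongrightarrow> qprod (\<lambda>n. 24 * Suc n)"
    by (rule LIMSEQ_Suc, rule qprod_tendsto) auto
  moreover have "qprod (\<lambda>n. 24 * Suc n) \<noteq> 0"
    using qprod_0[of "\<lambda>n. 24 * Suc n"] by fastforce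
  ultimately have "(\<lambda>n. 1 - fps_X ^ (24 * Suc n)) has_prod qprod (\<lambda>n. 24 * Suc n)"
    unfolding has_prod_def raw_has_prod_def lessThan_Suc_atMost add_0_right by blast
  then show ?thesis
    unfolding eq by (rule has_prod_unique[symmetric])
qed

text \<open>The factors are split by the parity of the exponent: the first \<open>2 * N\<close> of
  them consist of \<open>N\<close> even ones, which form the product at q^2, and \<open>N\<close>
  odd ones.\<close>

lemma euler_eq_odd_prod: "euler = (euler oo fps_X ^ 2) * odd_prod"
proof -
  have eq: "(\<Prod>k<2*N. 1 - fps_X ^ Suc k :: rat fps) =
      ((\<Prod>k<N. 1 - fps_X ^ Suc k) oo fps_X ^ 2) * (\<Prod>k<N. 1 - fps_X ^ (2 * k + 1))" for N
  proof (induction N)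
    case (Suc N)
    have 1: "(1 - fps_X ^ Suc N oo fps_X ^ 2 :: rat fps) = 1 - fps_X ^ Suc (Suc (2 * N))"
      by (simp only: fps_compose_sub_distrib fps_compose_1)
         (subst fps_X_power_compose, simp, simp only: power_mult[symmetric], simp)
    have 2: "(\<Prod>k<2*Suc N. 1 - fps_X ^ Suc k :: rat fps) =
        (\<Prod>k<2*N. 1 - fps_X ^ Suc k) * (1 - fps_X ^ (2 * N + 1)) * (1 - fps_X ^ Suc (Suc (2 * N)))"
    proof -
      have "2 * Suc N = Suc (Suc (2 * N))" by simp
      then show ?thesis
        unfolding Suc_eq_plus1[of "2 * N", symmetric] by (simp only: prod.lessThan_Suc)
    qed
    have 3: "((\<Prod>k<Suc N. 1 - fps_X ^ Suc k) oo fps_X ^ 2 :: rat fps) =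
        ((\<Prod>k<N. 1 - fps_X ^ Suc k) oo fps_X ^ 2) * (1 - fps_X ^ Suc (Suc (2 * N)))"
      unfolding prod.lessThan_Suc 1[symmetric] by (rule fps_compose_mult_distrib) simp
    have 4: "(\<Prod>k<Suc N. 1 - fps_X ^ (2 * k + 1) :: rat fps) =
        (\<Prod>k<N. 1 - fps_X ^ (2 * k + 1)) * (1 - fps_X ^ (2 * N + 1))"
      by (rule prod.lessThan_Suc)
    show ?case
      unfolding 2 3 4 Suc.IH by (simp only: mult_ac)
  qed simp
  have "(\<lambda>N. \<Prod>k<2*N. 1 - fps_X ^ Suc k :: rat fps) \<longlonglongrightarrow> euler"
    using euler_tendsto by (rule filterlim_compose) (auto intro!: mult_nat_left_at_top)
  moreover have "(\<lambda>N. ((\<Prod>k<N. 1 - fps_X ^ Suc k) oo fps_X ^ 2) *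
      (\<Prod>k<N. 1 - fps_X ^ (2 * k + 1))) \<longlonglongrightarrow> (euler oo fps_X ^ 2) * odd_prod"
    unfolding odd_prod_def
    by (intro tendsto_fps_mult tendsto_fps_compose_left euler_tendsto qprod_tendsto) simp
  ultimately show ?thesis
    unfolding eq by (rule LIMSEQ_unique)
qed

text \<open>For odd exponents q -> -q turns 1 - y into 1 + y, and (1 - y)(1 + y) = 1 - y^2.\<close>

lemma odd_prod_minus: "odd_prod * (odd_prod oo - fps_X) = odd_prod oo fps_X ^ 2"
proof -
  have lim: "(\<lambda>N. \<Prod>k<N. 1 - fps_X ^ (2 * k + 1)) \<longlonglongrightarrow> odd_prod"
    unfolding odd_prod_def by (rule qprod_tendsto) simp
  have eq: "(\<Prod>k<N. 1 - fps_X ^ (2 * k + 1)) * ((\<Prod>k<N. 1 - fps_X ^ (2 * k + 1)) oo - fps_X) =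
      ((\<Prod>k<N. 1 - fps_X ^ (2 * k + 1)) oo fps_X ^ 2 :: rat fps)" for N
  proof -
    have "(1 - fps_X ^ (2 * k + 1)) * (1 + fps_X ^ (2 * k + 1)) =
        (1 - (fps_X ^ 2) ^ (2 * k + 1) :: rat fps)" for k
    proof -
      have "(1 - y) * (1 + y) = 1 - y ^ 2" for y :: "rat fps"
        by (simp add: algebra_simps power2_eq_square)
      then show ?thesis by (metis power_mult mult.commute)
    qed
    moreover have "(- fps_X) ^ (2 * k + 1) = - (fps_X ^ (2 * k + 1) :: rat fps)" for k
      by simp
    ultimately show ?thesis
      by (simp add: fps_compose_prod_distrib fps_compose_sub_distrib fps_X_power_compose
         del: power_Suc flip: prod.distrib)
  qed
  have "(\<lambda>N. (\<Prod>k<N. 1 - fps_X ^ (2 * k + 1)) * ((\<Prod>k<N. 1 - fps_X ^ (2 * k + 1)) oo - fps_X))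
     \<longlonglongrightarrow> odd_prod * (odd_prod oo - fps_X)"
    by (intro tendsto_fps_mult tendsto_fps_compose_left lim)
  moreover have "(\<lambda>N. (\<Prod>k<N. 1 - fps_X ^ (2 * k + 1)) oo fps_X ^ 2) \<longlonglongrightarrow> (odd_prod oo fps_X ^ 2)"
    by (intro tendsto_fps_compose_left lim)
  ultimately show ?thesis
    unfolding eq by (rule LIMSEQ_unique)
qed

lemma fps_compose_X_power_X_power:
  fixes f :: "'a::idom fps"
  assumes "m > 0" "n > 0"
  shows "f oo fps_X ^ m oo fps_X ^ n = f oo fps_X ^ (m * n)"
proof -
  have "f oo (fps_X ^ m oo fps_X ^ n) = f oo fps_X ^ m oo fps_X ^ n"
    using assms by (intro fps_compose_assoc) auto
  then show ?thesis
    using assms by (simp add: fps_X_power_compose mult.commute flip: power_mult)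
qed

lemma fps_compose_X_power_minus_X:
  fixes f :: "'a::idom fps"
  assumes "m > 0" "even m"
  shows "f oo fps_X ^ m oo - fps_X = f oo fps_X ^ m"
proof -
  have "f oo (fps_X ^ m oo - fps_X) = f oo fps_X ^ m oo - fps_X"
    using assms by (intro fps_compose_assoc) auto
  then show ?thesis
    using assms by (simp add: fps_X_power_compose)
qed

text \<open>Only the factor \<open>odd_prod\<close> of \<open>euler\<close> changes under q -> -q.
  Its product with its transform is \<open>odd_prod\<close> at q^2, which
  \<open>euler oo fps_X ^ 4\<close> completes to one more \<open>euler oo fps_X ^ 2\<close>.\<close>

lemma euler_minus:
  "euler * (euler oo - fps_X) * (euler oo fps_X ^ 4) = (euler oo fps_X ^ 2) ^ 3"
proof -
  let ?e2 = "euler oo fps_X ^ 2" and ?o = odd_prod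
  have m: "euler oo - fps_X = ?e2 * (?o oo - fps_X)"
    by (subst euler_eq_odd_prod) (simp add: fps_compose_mult_distrib fps_compose_X_power_minus_X)
  have 4: "?e2 = (euler oo fps_X ^ 4) * (?o oo fps_X ^ 2)"
    by (subst euler_eq_odd_prod) (simp add: fps_compose_mult_distrib fps_compose_X_power_X_power)
  have "euler * (euler oo - fps_X) * (euler oo fps_X ^ 4) =
      ?e2 * ?e2 * ((euler oo fps_X ^ 4) * (?o * (?o oo - fps_X)))"
    by (subst euler_eq_odd_prod, subst m) (simp add: mult_ac)
  also have "\<dots> = ?e2 * ?e2 * ?e2"
    unfolding odd_prod_minus by (subst (5) 4) simp
  finally show ?thesis by (simp add: power3_eq_cube)
qed

section \<open>Theta series\<close>

text \<open>
  Shanks' finite form of Gauss' identity \<open>\<Sum> (-1)\<^sup>j q\<^bsup>j^2\<^esup> = \<Prod> (1 - q\<^sup>n) / (1 + q\<^sup>n)\<close>: with \<open>P n\<close> the partial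
  product, every summand with \<open>s > 0\<close> is divisible by \<open>q\<^bsup>n+1\<^esup>\<close>. In the induction the difference of
  consecutive left-hand sides telescopes through \<open>G\<close>.
\<close>

lemma shanks_identity:
  fixes q :: "'a::idom" and P I r :: "nat \<Rightarrow> 'a"
  assumes P: "P 0 = 1" "\<And>n. P (Suc n) * (1 + q ^ Suc n) = P n * (1 - q ^ Suc n)"
    and I: "\<And>n. I (Suc n) * (1 - q ^ Suc n) = I n * (1 + q ^ Suc n)"
    and PI: "\<And>n. P n * I n = 1" and r: "\<And>n. r n * (1 + q ^ n) = 1"
  shows "(\<Sum>s\<le>n. (-1) ^ s * 2 * q ^ (s * Suc n) * P n * I s * r s) =
    1 + 2 * (\<Sum>s=1..n. (-1) ^ s * q ^ (s ^ 2))"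
proof (induction n)
  case 0
  show ?case using r[of 0] PI[of 0] P(1) by (simp add: mult.commute)
next
  case (Suc n)
  define N where "N = Suc n"
  define F where "F = (\<lambda>n s. (-1) ^ s * 2 * q ^ (s * Suc n) * P n * I s * r s)"
  \<comment> \<open>The telescoping certificate for the difference of \<open>F N\<close> and
    \<open>F n\<close>. Its value 0 at \<open>s = 0\<close> is forced by the first summand; the
    general formula would give 1 there.\<close>
  define G where "G = (\<lambda>s. if s = 0 then 0 else (-1) ^ s * q ^ (s * N) * I (s - 1))"
  have key: "(1 + q ^ N) * (F N s - F n s) = 2 * P n * (G (Suc s) - G s)" for s
  proof (cases s)
    case 0
    have "2 * r 0 = 1" "I 0 = 1"
      using r[of 0] PI[of 0] P(1) by (simp_all add: mult.commute)
    then have "F N s = P N" "F n s = P n"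
      unfolding F_def 0 by (simp_all add: algebra_simps)
    then show ?thesis
      using P(2)[of n] \<open>I 0 = 1\<close> unfolding G_def 0 N_def[symmetric]
      by (simp add: algebra_simps)
  next
    case (Suc m)
    \<comment> \<open>With letters for the powers of q the claim is polynomial and follows from the
      recurrences of \<open>P\<close> and \<open>I\<close> and from \<open>r\<close>.\<close>
    define b where "b = q ^ s"
    define c where "c = q ^ N"
    define w where "w = (-1) ^ s * q ^ (s * N)"
    have "F N s = 2 * w * b * P N * I s * r s" "F n s = 2 * w * P n * I s * r s"
      unfolding F_def w_def b_def N_def by (simp_all add: power_add algebra_simps)
    moreover have "G (Suc s) = - (w * c * I s)" "G s = w * I m"
      unfolding G_def w_def c_def Suc by (simp_all add: power_add algebra_simps)
    moreover have "P N * (1 + c) = P n * (1 - c)" "I s * (1 - b) = I m * (1 + b)"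
        "r s * (1 + b) = 1"
      using P(2)[of n] I[of m] r[of s] unfolding c_def b_def N_def Suc by simp_all
    ultimately show ?thesis
      unfolding c_def[symmetric] by algebra
  qed
  define w where "w = (-1) ^ N * q ^ (N * N)"
  have "(1 + q ^ N) * ((\<Sum>s\<le>n. F N s) - (\<Sum>s\<le>n. F n s)) =
      2 * P n * (\<Sum>s\<le>n. G (Suc s) - G s)"
    by (simp only: sum_subtractf[symmetric] sum_distrib_left key)
  also have "(\<Sum>s\<le>n. G (Suc s) - G s) = G N - G 0"
    unfolding N_def by (induction n) auto
  also have "\<dots> = w * I n"
    by (simp add: G_def N_def w_def)
  also have "2 * P n * (w * I n) = 2 * w * (P n * I n)"
    by (simp only: mult_ac)
  finally have 1: "(1 + q ^ N) * ((\<Sum>s\<le>n. F N s) - (\<Sum>s\<le>n. F n s)) = 2 * w"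
    by (simp add: PI)
  have "F N N = 2 * w * q ^ N * (P N * I N) * r N"
    unfolding F_def w_def by (simp add: power_add algebra_simps)
  then have "F N N = 2 * w * q ^ N * r N"
    using PI by simp
  \<comment> \<open>The telescoped sum contributes 2w / (1 + q^N) and the new summand 2w q^N / (1 +
    q^N); together they give 2w.\<close>
  then have "(\<Sum>s\<le>n. F N s) + F N N = (\<Sum>s\<le>n. F n s) + 2 * w"
  proof -
    have "A + f = B + 2 * w" if "f = 2 * w * c * t" "(1 + c) * (A - B) = 2 * w" "t * (1 + c) = 1"
      for A B c f t :: 'a
      using that by algebra
    then show ?thesis using 1 r[of N] \<open>F N N = 2 * w * q ^ N * r N\<close> by blast
  qed
  moreover have "(\<Sum>s\<le>N. F N s) = (\<Sum>s\<le>n. F N s) + F N N"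
    unfolding N_def by simp
  moreover have "(\<Sum>s\<le>n. F n s) = 1 + 2 * (\<Sum>s=1..n. (-1) ^ s * q ^ (s ^ 2))"
    unfolding F_def by (rule Suc.IH)
  moreover have "(\<Sum>s=1..N. (-1) ^ s * q ^ (s ^ 2)) =
      (\<Sum>s=1..n. (-1) ^ s * q ^ (s ^ 2)) + w"
    unfolding N_def w_def by (simp add: power2_eq_square)
  ultimately have "(\<Sum>s\<le>N. F N s) = 1 + 2 * (\<Sum>s=1..N. (-1) ^ s * q ^ (s ^ 2))"
    by (simp add: algebra_simps)
  then show ?case
    unfolding F_def N_def .
qed

text \<open>The series \<phi>(q). Counting the roots \<open>j\<close> over all integers makes the
  coefficients of \<open>theta ^ 2\<close> count representations as a sum of two squares.\<close>

definition theta :: "rat fps" where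
  "theta = Abs_fps (\<lambda>k. of_nat (card {j :: int. j ^ 2 = int k}))"

lemma card_square_roots:
  "card {j :: int. j ^ 2 = int k} = (if k = 0 then 1 else if \<exists>s. k = s ^ 2 then 2 else 0)"
proof -
  consider "k = 0" | s where "k = s ^ 2" "s > 0" | "\<not> (\<exists>s. k = s ^ 2)"
    by (metis gr0I zero_power2)
  then show ?thesis
  proof cases
    case 1
    then show ?thesis by simp
  next
    case 2
    have "{j :: int. j ^ 2 = int k} = {int s, - int s}"
      unfolding 2 by (auto simp: power2_eq_iff)
    then show ?thesis using 2 by auto
  next
    case 3
    have "{j :: int. j ^ 2 = int k} = {}"
    proof (rule ccontr)
      assume "\<not> ?thesis"
      then obtain j :: int where "j ^ 2 = int k" by blast
      then have "int ((nat \<bar>j\<bar>) ^ 2) = int k" by simp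
      then show False using 3 by (metis of_nat_eq_iff)
    qed
    moreover have "k \<noteq> 0" using 3 by (metis zero_power2)
    ultimately show ?thesis using 3 by auto
  qed
qed

lemma theta_partial_sum_tendsto:
  "(\<lambda>n. 1 + 2 * (\<Sum>s=1..n. (-1) ^ s * fps_X ^ (s ^ 2))) \<longlonglongrightarrow> (theta oo - fps_X)"
proof (rule tendsto_fpsI)
  fix k
  have "(1 + 2 * (\<Sum>s=1..n. (-1) ^ s * fps_X ^ (s ^ 2))) $ k = (theta oo - fps_X) $ k"
    if "n \<ge> k" for n
  proof -
    \<comment> \<open>The sign may be taken from \<open>k\<close>, since \<open>s\<close> and
      \<open>s ^ 2\<close> have the same parity.\<close>
    have "((-1) ^ s * fps_X ^ (s ^ 2) :: rat fps) $ k = (if k = s ^ 2 then (-1) ^ k else 0)" for s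
    proof -
      have "((-1) ^ s :: rat fps) = fps_const ((-1) ^ s)"
        by (simp flip: fps_const_power fps_const_neg)
      then show ?thesis by (simp add: minus_one_power_iff)
    qed
    then have "(\<Sum>s=1..n. (-1) ^ s * fps_X ^ (s ^ 2) :: rat fps) $ k =
        (\<Sum>s=1..n. if k = s ^ 2 then (-1) ^ k else 0)"
      by (simp add: fps_sum_nth)
    also have "\<dots> = (if k \<noteq> 0 \<and> (\<exists>s. k = s ^ 2) then (-1) ^ k else 0)"
    proof (cases "k \<noteq> 0 \<and> (\<exists>s. k = s ^ 2)")
      case True
      then obtain s where s: "k = s ^ 2" "s > 0" by (metis gr0I zero_power2)
      have "s \<le> n" using s that by (metis le_trans power2_nat_le_imp_le order_refl)
      have "(\<Sum>s=1..n. if k = s ^ 2 then (-1) ^ k else 0 :: rat) = (\<Sum>i\<in>{s}. (-1) ^ k)"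
        using s \<open>s \<le> n\<close> by (intro sum.mono_neutral_cong_right) (auto simp: power2_eq_iff_nonneg)
      then show ?thesis using True by simp
    next
      case False
      then show ?thesis by (intro trans[OF sum.neutral]) auto
    qed
    finally have sum: "(\<Sum>s=1..n. (-1) ^ s * fps_X ^ (s ^ 2) :: rat fps) $ k =
        (if k \<noteq> 0 \<and> (\<exists>s. k = s ^ 2) then (-1) ^ k else 0)" .
    have "(1 + 2 * (\<Sum>s=1..n. (-1) ^ s * fps_X ^ (s ^ 2) :: rat fps)) $ k =
        (if k = 0 then 1 else 0) + 2 * (\<Sum>s=1..n. (-1) ^ s * fps_X ^ (s ^ 2) :: rat fps) $ k"
      by (simp only: mult_2 fps_add_nth fps_one_nth)
    then show ?thesis
      unfolding sum fps_compose_uminus' theta_def card_square_roots by simp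
  qed
  then show "\<forall>\<^sub>F n in sequentially.
      (1 + 2 * (\<Sum>s=1..n. (-1) ^ s * fps_X ^ (s ^ 2))) $ k = (theta oo - fps_X) $ k"
    unfolding eventually_sequentially by blast
qed

text \<open>The limit of \<open>shanks_identity\<close>: the partial theta sum \<open>S n\<close>
  agrees with \<open>P n\<close> modulo q^(n+1), and \<open>P n\<close> times the finite Euler
  product at q^2 is the square of the finite Euler product at q.\<close>

lemma gauss_theta: "(euler oo fps_X ^ 2) * (theta oo - fps_X) = euler ^ 2"
proof -
  define c where "c = (\<lambda>k. 1 - fps_X ^ k :: rat fps)"
  define p where "p = (\<lambda>k. 1 + fps_X ^ k :: rat fps)"
  define P where "P = (\<lambda>n. \<Prod>k<n. c (Suc k) * inverse (p (Suc k)))"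
  define I where "I = (\<lambda>n. \<Prod>k<n. inverse (c (Suc k)) * p (Suc k))"
  define E where "E = (\<lambda>n. \<Prod>k<n. c (Suc k))"
  define S where "S = (\<lambda>n. 1 + 2 * (\<Sum>s=1..n. (-1) ^ s * fps_X ^ (s ^ 2)) :: rat fps)"
  have c_eq: "1 - fps_X ^ k = c k" and p_eq: "1 + fps_X ^ k = p k" for k
    by (simp_all add: c_def p_def)
  have p: "inverse (p k) * p k = 1" for k
    by (rule inverse_mult_eq_1) (cases k; simp add: p_def)
  have c: "inverse (c (Suc k)) * c (Suc k) = 1" for k
    by (rule inverse_mult_eq_1) (simp add: c_def)
  have cp: "c k * p k = (c k oo fps_X ^ 2)" for k
  proof -
    have "c k * p k = 1 - fps_X ^ k * fps_X ^ k"
      by (simp add: c_def p_def algebra_simps)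
    then show ?thesis
      by (simp add: c_def fps_compose_sub_distrib fps_X_power_compose flip: power_mult power_add mult_2)
  qed
  have PI: "P n * I n = 1" for n
  proof -
    have "(c (Suc k) * inverse (p (Suc k))) * (inverse (c (Suc k)) * p (Suc k)) = 1" for k
      using p[of "Suc k"] c[of k] by algebra
    then show ?thesis unfolding P_def I_def prod.distrib[symmetric] by simp
  qed
  have PE: "(E n oo fps_X ^ 2) * P n = E n ^ 2" for n
  proof -
    have "(c (Suc k) oo fps_X ^ 2) * (c (Suc k) * inverse (p (Suc k))) = c (Suc k) ^ 2" for k
      using p[of "Suc k"] cp[of "Suc k"] by algebra
    moreover have "E n oo fps_X ^ 2 = (\<Prod>k<n. c (Suc k) oo fps_X ^ 2)"
      unfolding E_def by (rule fps_compose_prod_distrib) simp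
    ultimately show ?thesis
      unfolding E_def P_def by (simp add: prod_power_distrib flip: prod.distrib)
  qed
  have "\<exists>R. S n = P n + fps_X ^ Suc n * R" for n
  proof -
    have "S n = (\<Sum>s\<le>n. (-1) ^ s * 2 * fps_X ^ (s * Suc n) * P n * I s * inverse (p s))"
      unfolding S_def
    proof (rule shanks_identity[symmetric])
      show "P (Suc n) * (1 + fps_X ^ Suc n) = P n * (1 - fps_X ^ Suc n)" for n
        using p[of "Suc n"] unfolding P_def prod.lessThan_Suc
        unfolding c_eq p_eq by algebra
      show "I (Suc n) * (1 - fps_X ^ Suc n) = I n * (1 + fps_X ^ Suc n)" for n
        using c[of n] unfolding I_def prod.lessThan_Suc
        unfolding c_eq p_eq by algebra
      show "inverse (p n) * (1 + fps_X ^ n) = 1" for n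
        using p[of n] unfolding p_def .
    qed (simp_all add: PI, simp add: P_def)
    also have "{..n} = insert 0 {Suc 0..n}" by auto
    also have "(\<Sum>s\<in>insert 0 {Suc 0..n}. (-1) ^ s * 2 * fps_X ^ (s * Suc n) * P n * I s * inverse (p s)) =
        2 * P n * inverse (p 0) +
        (\<Sum>s=Suc 0..n. (-1) ^ s * 2 * fps_X ^ (s * Suc n) * P n * I s * inverse (p s))"
      by (subst sum.insert) (simp_all add: I_def)
    \<comment> \<open>\<open>p 0\<close> is the constant 2, so its inverse absorbs the factor
      2.\<close>
    also have "2 * P n * inverse (p 0) = P n"
      using p[of 0] by (simp add: p_def mult.commute mult.left_commute)
    also have "(\<Sum>s=Suc 0..n. (-1) ^ s * 2 * fps_X ^ (s * Suc n) * P n * I s * inverse (p s)) =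
        fps_X ^ Suc n *
        (\<Sum>s=Suc 0..n. (-1) ^ s * 2 * fps_X ^ ((s - 1) * Suc n) * P n * I s * inverse (p s))"
      unfolding sum_distrib_left
    proof (intro sum.cong refl)
      fix s assume "s \<in> {Suc 0..n}"
      then have "s * Suc n = Suc n + (s - 1) * Suc n"
        by (cases s) auto
      then have *: "fps_X ^ (s * Suc n) = (fps_X ^ Suc n * fps_X ^ ((s - 1) * Suc n) :: rat fps)"
        by (metis power_add)
      show "(-1) ^ s * 2 * fps_X ^ (s * Suc n) * P n * I s * inverse (p s) = fps_X ^ Suc n *
          ((-1) ^ s * 2 * fps_X ^ ((s - 1) * Suc n) * P n * I s * inverse (p s))"
        unfolding * by (simp only: mult_ac)
    qed
    finally show ?thesis by blast
  qed
  then obtain R where R: "\<And>n. S n = P n + fps_X ^ Suc n * R n" by metis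
  have E: "E \<longlonglongrightarrow> euler"
    unfolding E_def c_def by (rule euler_tendsto)
  have "(\<lambda>n. (E n oo fps_X ^ 2) * S n) \<longlonglongrightarrow> (euler oo fps_X ^ 2) * (theta oo - fps_X)"
    unfolding S_def by (intro tendsto_fps_mult tendsto_fps_compose_left E theta_partial_sum_tendsto)
  moreover have "(\<lambda>n. (E n oo fps_X ^ 2) * S n) \<longlonglongrightarrow> euler ^ 2"
  proof (rule tendsto_fpsI)
    fix k
    have "(\<lambda>n. E n ^ 2) \<longlonglongrightarrow> euler ^ 2"
      unfolding power2_eq_square by (intro tendsto_fps_mult E)
    then have "\<forall>\<^sub>F n in sequentially. (E n ^ 2) $ k = (euler ^ 2) $ k"
      by (simp add: tendsto_fps_iff)
    then show "\<forall>\<^sub>F n in sequentially. ((E n oo fps_X ^ 2) * S n) $ k = (euler ^ 2) $ k"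
      using eventually_ge_at_top[of k]
    proof eventually_elim
      case (elim n)
      have "(E n oo fps_X ^ 2) * S n = E n ^ 2 + fps_X ^ Suc n * ((E n oo fps_X ^ 2) * R n)"
        unfolding R PE[symmetric] by (simp only: distrib_left mult_ac)
      then show ?case using elim by (simp del: power_Suc add: fps_X_power_mult_nth)
    qed
  qed
  ultimately show ?thesis by (rule LIMSEQ_unique)
qed

section \<open>Sums of two squares and the duplication formula for theta\<close>

lemma theta_square_nth:
  "(theta ^ 2) $ k = of_nat (card {(a :: int, b). a ^ 2 + b ^ 2 = int k})"
proof -
  have fin: "finite {j :: int. j ^ 2 = int i}" for i
  proof (rule finite_subset)
    have "\<bar>j\<bar> \<le> j ^ 2" for j :: int
      using self_le_power[of "\<bar>j\<bar>" 2] by (cases "j = 0") auto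
    then show "{j. j ^ 2 = int i} \<subseteq> {- int i..int i}"
      by (auto simp: abs_le_iff) (metis abs_le_iff neg_le_iff_le minus_le_iff)+
  qed simp
  \<comment> \<open>Sorting the pairs by \<open>i = a ^ 2\<close> turns the count into a Cauchy
    product.\<close>
  have "card {(a :: int, b). a ^ 2 + b ^ 2 = int k} =
      card (SIGMA i:{0..k}. {j :: int. j ^ 2 = int i} \<times> {j :: int. j ^ 2 = int (k - i)})"
  proof (rule bij_betw_same_card[symmetric])
    show "bij_betw snd (SIGMA i:{0..k}. {j :: int. j ^ 2 = int i} \<times> {j :: int. j ^ 2 = int (k - i)})
        {(a :: int, b). a ^ 2 + b ^ 2 = int k}"
    proof (rule bij_betw_byWitness[where f' = "\<lambda>(a, b). (nat (a ^ 2), a, b)"])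
      show "(\<lambda>(a, b). (nat (a ^ 2), a, b)) ` {(a :: int, b). a ^ 2 + b ^ 2 = int k}
          \<subseteq> (SIGMA i:{0..k}. {j. j ^ 2 = int i} \<times> {j. j ^ 2 = int (k - i)})"
      proof clarify
        fix a b :: int
        assume *: "a ^ 2 + b ^ 2 = int k"
        have le: "a ^ 2 \<le> int k" using * zero_le_power2[of b] by linarith
        have "b ^ 2 = int k - a ^ 2" using * by simp
        then show "nat (a ^ 2) \<in> {0..k} \<and> (a, b) \<in> {j. j ^ 2 = int (nat (a ^ 2))}
            \<times> {j. j ^ 2 = int (k - nat (a ^ 2))}"
          using le by (auto simp: nat_le_iff of_nat_diff)
      qed
    qed auto
  qed
  also have "\<dots> = (\<Sum>i=0..k. card {j :: int. j ^ 2 = int i} * card {j :: int. j ^ 2 = int (k - i)})"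
    by (subst card_SigmaI) (simp_all only: fin finite_cartesian_product card_cartesian_product
        finite_atLeastAtMost ball_triv simp_thms)
  finally show ?thesis
    by (simp add: theta_def power2_eq_square fps_mult_nth)
qed

text \<open>k and 2k have equally many representations as a sum of two squares: (a, b) -> (a + b, a
  - b) is invertible, because the entries of a pair with even sum of squares have equal
  parity.\<close>

lemma U2_theta_square: "U2 (theta ^ 2) = theta ^ 2"
proof (rule fps_ext)
  fix k
  have "card {(a :: int, b). a ^ 2 + b ^ 2 = int k} = card {(a :: int, b). a ^ 2 + b ^ 2 = int (2 * k)}"
  proof (rule bij_betw_same_card)
    show "bij_betw (\<lambda>(a, b). (a + b, a - b)) {(a :: int, b). a ^ 2 + b ^ 2 = int k}
        {(a :: int, b). a ^ 2 + b ^ 2 = int (2 * k)}"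
    proof (rule bij_betw_byWitness[where f' = "\<lambda>(c, d). ((c + d) div 2, (c - d) div 2)"])
      show "(\<lambda>(c, d). ((c + d) div 2, (c - d) div 2)) ` {(a :: int, b). a ^ 2 + b ^ 2 = int (2 * k)}
          \<subseteq> {(a, b). a ^ 2 + b ^ 2 = int k}"
        "\<forall>x\<in>{(a :: int, b). a ^ 2 + b ^ 2 = int (2 * k)}.
          (\<lambda>(a, b). (a + b, a - b)) ((\<lambda>(c, d). ((c + d) div 2, (c - d) div 2)) x) = x"
      proof -
        have *: "\<exists>a b. c = a + b \<and> d = a - b \<and> a ^ 2 + b ^ 2 = int k"
          if "c ^ 2 + d ^ 2 = 2 * int k" for c d :: int
        proof -
          have "even (c ^ 2 + d ^ 2)" using that by simp
          then have "even (c + d)" by simp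
          then obtain a where a: "c + d = 2 * a" by (elim evenE)
          have "c = a + (c - a)" "d = a - (c - a)" using a by simp_all
          moreover have "a ^ 2 + (c - a) ^ 2 = int k"
          proof -
            have "2 * (a ^ 2 + (c - a) ^ 2) = c ^ 2 + (2 * a - c) ^ 2"
              by (simp add: power2_eq_square algebra_simps)
            also have "\<dots> = 2 * int k" using that a by (simp flip: a)
            finally show ?thesis by simp
          qed
          ultimately show ?thesis by blast
        qed
        show "(\<lambda>(c, d). ((c + d) div 2, (c - d) div 2)) ` {(a :: int, b). a ^ 2 + b ^ 2 = int (2 * k)}
          \<subseteq> {(a, b). a ^ 2 + b ^ 2 = int k}"
          by (auto dest!: *)
        show "\<forall>x\<in>{(a :: int, b). a ^ 2 + b ^ 2 = int (2 * k)}.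
          (\<lambda>(a, b). (a + b, a - b)) ((\<lambda>(c, d). ((c + d) div 2, (c - d) div 2)) x) = x"
          by (auto dest!: *)
      qed
      show "(\<lambda>(a, b). (a + b, a - b)) ` {(a :: int, b). a ^ 2 + b ^ 2 = int k}
          \<subseteq> {(a, b). a ^ 2 + b ^ 2 = int (2 * k)}"
        by (auto simp: power2_eq_square algebra_simps)
    qed auto
  qed
  then show "U2 (theta ^ 2) $ k = (theta ^ 2) $ k"
    by (simp add: U2_def theta_square_nth)
qed

text \<open>The arithmetic-mean half of the AGM relations between theta values. The geometric half,
  \<open>p * m = m2 ^ 2\<close> in \<open>theta_fourth_powers\<close>, comes from
  \<open>theta_mult\<close>.\<close>

lemma theta_square_minus: "theta ^ 2 + (theta ^ 2 oo - fps_X) = 2 * (theta ^ 2 oo fps_X ^ 2)"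
  unfolding fps_even_part U2_theta_square ..

section \<open>Jacobi's identity and the logarithmic derivative\<close>

definition sigma_series :: "rat fps" where
  "sigma_series = Abs_fps (\<lambda>n. if n = 0 then 0 else \<Sum>d | d dvd n. of_nat d)"

text \<open>Logarithmic derivatives add up; the hypothesis is written as a product to avoid
  quotients.\<close>

lemma fps_XD_prod:
  fixes f :: "'b \<Rightarrow> 'a::comm_ring_1 fps"
  assumes "\<And>k. fps_XD (f k) = f k * g k"
  shows "fps_XD (prod f A) = prod f A * sum g A"
proof (induction A rule: infinite_finite_induct)
  case (insert a A)
  then show ?case by (simp add: fps_XD_mult assms algebra_simps)
qed (simp_all add: fps_XD_def)

lemma fps_XD_euler: "fps_XD euler = - (sigma_series * euler)"
proof -
  \<comment> \<open>\<open>M m\<close> is the expansion of m q^m / (1 - q^m), minus the logarithmic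
    derivative of 1 - q^m. Summing over m collects the divisors of each n.\<close>
  define M where "M = (\<lambda>m. Abs_fps (\<lambda>n. if m dvd n \<and> n > 0 then of_nat m else 0) :: rat fps)"
  have M: "fps_XD (1 - fps_X ^ Suc k) = (1 - fps_X ^ Suc k) * (- M (Suc k))" for k
  proof (rule fps_ext)
    fix n
    have "((1 - fps_X ^ Suc k) * (- M (Suc k))) $ n =
        - (M (Suc k) $ n) + (if n < Suc k then 0 else M (Suc k) $ (n - Suc k))"
      by (simp add: left_diff_distrib fps_X_power_mult_nth del: power_Suc)
    also have "\<dots> = fps_XD (1 - fps_X ^ Suc k) $ n"
      by (auto simp: M_def dvd_minus_self fps_X_power_nth simp del: power_Suc dest: dvd_imp_le)
    finally show "fps_XD (1 - fps_X ^ Suc k) $ n = ((1 - fps_X ^ Suc k) * (- M (Suc k))) $ n" ..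
  qed
  have "(\<lambda>N. \<Sum>k<N. - M (Suc k)) \<longlonglongrightarrow> - sigma_series"
  proof (rule tendsto_fpsI)
    fix n
    have "(\<Sum>k<N. - M (Suc k)) $ n = (- sigma_series) $ n" if "N \<ge> n" for N
    proof (cases "n = 0")
      case True
      then show ?thesis by (simp add: fps_sum_nth sigma_series_def M_def)
    next
      case False
      have "(\<Sum>k<N. M (Suc k) $ n) = (\<Sum>k\<in>{..<N}. if Suc k dvd n then of_nat (Suc k) else 0)"
        using False by (simp add: M_def)
      also have "\<dots> = (\<Sum>k | Suc k dvd n. of_nat (Suc k))"
      proof (rule sum.mono_neutral_cong_right)
        show "{k. Suc k dvd n} \<subseteq> {..<N}"
          using False that by (auto dest!: dvd_imp_le)
      qed auto
      also have "\<dots> = (\<Sum>d | d dvd n. of_nat d)"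
        using False by (intro sum.reindex_bij_witness[of _ "\<lambda>d. d - 1" Suc]) (auto simp: Suc_diff_1 intro!: gr0I)
      finally show ?thesis
        using False by (simp add: fps_sum_nth sigma_series_def sum_negf)
    qed
    then show "\<forall>\<^sub>F N in sequentially. (\<Sum>k<N. - M (Suc k)) $ n = (- sigma_series) $ n"
      unfolding eventually_sequentially by blast
  qed
  then have "(\<lambda>N. (\<Prod>k<N. 1 - fps_X ^ Suc k) * (\<Sum>k<N. - M (Suc k))) \<longlonglongrightarrow> euler * (- sigma_series)"
    by (intro tendsto_fps_mult euler_tendsto)
  moreover have "(\<lambda>N. fps_XD (\<Prod>k<N. 1 - fps_X ^ Suc k)) \<longlonglongrightarrow> fps_XD euler"
    by (intro tendsto_fps_XD euler_tendsto)
  ultimately have "fps_XD euler = euler * (- sigma_series)"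
    unfolding fps_XD_prod[OF M] by (intro LIMSEQ_unique)
  then show ?thesis by simp
qed

section \<open>Jacobi's identity for the fourth powers of theta values\<close>

lemma fps_compose_minus_X_minus_X: "f oo - fps_X oo - fps_X = (f :: 'a::comm_ring_1 fps)"
  by (rule fps_ext) (simp add: fps_compose_uminus' flip: power_mult_distrib)

text \<open>Write r = 1 + d, so that d^2 + 2d = d(q^2). If d were nonzero with lowest exponent n >
  0, then 2d would be the only term contributing to q^n.\<close>

lemma fps_square_eq_dilation:
  fixes r :: "'a::{idom, ring_char_0} fps"
  assumes "r ^ 2 = r oo fps_X ^ 2" "r $ 0 = 1"
  shows "r = 1"
proof (rule ccontr)
  assume "r \<noteq> 1"
  define d where "d = r - 1"
  define n where "n = subdegree d"
  have "d \<noteq> 0" "d $ 0 = 0" using \<open>r \<noteq> 1\<close> assms(2) by (simp_all add: d_def)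
  then have n: "n > 0" "d $ n \<noteq> 0"
    unfolding n_def by (auto simp: subdegree_eq_0_iff intro!: gr0I)
  have "(d ^ 2) $ n = 0"
    using \<open>d \<noteq> 0\<close> n(1) unfolding n_def power2_eq_square
    by (intro nth_less_subdegree_zero) simp
  moreover have "(d oo fps_X ^ 2) $ n = 0"
    using n(1) unfolding n_def by (auto simp: fps_nth_compose_X_power intro!: nth_less_subdegree_zero)
  moreover have "d ^ 2 + (d + d) = d oo fps_X ^ 2"
    using assms(1) unfolding d_def
    by (simp add: fps_compose_sub_distrib power2_eq_square algebra_simps)
  then have "(d ^ 2) $ n + (d $ n + d $ n) = (d oo fps_X ^ 2) $ n"
    by (metis fps_add_nth)
  ultimately show False using n(2) by (simp flip: mult_2)
qed

text \<open>Gauss' identity at -q expresses \<open>theta\<close> through \<open>euler\<close> at -q,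
  and \<open>euler_minus\<close> eliminates the latter. Each relation is first proved with an extra
  factor \<open>e2\<close>, which is then cancelled.\<close>

lemma theta_mult: "theta * (theta oo - fps_X) * (euler oo fps_X ^ 4) ^ 2 = (euler oo fps_X ^ 2) ^ 4"
  and theta_euler: "theta * euler ^ 2 * (euler oo fps_X ^ 4) ^ 2 = (euler oo fps_X ^ 2) ^ 5"
proof -
  define e e2 e4 m where "e = euler" "e2 = euler oo fps_X ^ 2" "e4 = euler oo fps_X ^ 4"
    "m = euler oo - fps_X"
  note defs = this
  have "e2 $ 0 = 1" by (simp add: defs)
  then have nz: "e2 \<noteq> 0" by auto
  have 1: "e * m * e4 = e2 ^ 3"
    unfolding defs by (rule euler_minus)
  have 2: "e2 * (theta oo - fps_X) = e ^ 2"
    unfolding defs by (rule gauss_theta)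
  have "(e2 * (theta oo - fps_X)) oo - fps_X = e ^ 2 oo - fps_X"
    unfolding 2 ..
  then have 3: "e2 * theta = m ^ 2"
    by (simp add: defs fps_compose_mult_distrib fps_compose_X_power_minus_X
        fps_compose_minus_X_minus_X fps_compose_power)
  have "e2 * (theta * e ^ 2 * e4 ^ 2) = e2 * e2 ^ 5"
    using 1 3 by algebra
  then have 4: "theta * e ^ 2 * e4 ^ 2 = e2 ^ 5"
    using nz by simp
  have "e2 * (theta * (theta oo - fps_X) * e4 ^ 2) = e2 * e2 ^ 4"
    using 4 2 by algebra
  then have 5: "theta * (theta oo - fps_X) * e4 ^ 2 = e2 ^ 4"
    using nz by simp
  show "theta * (theta oo - fps_X) * (euler oo fps_X ^ 4) ^ 2 = (euler oo fps_X ^ 2) ^ 4"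
    using 5 unfolding defs .
  show "theta * euler ^ 2 * (euler oo fps_X ^ 4) ^ 2 = (euler oo fps_X ^ 2) ^ 5"
    using 4 unfolding defs .
qed

text \<open>
  Both \<open>A = \<phi>(q)\<^sup>4 - \<phi>(-q)\<^sup>4\<close> and the product on the right satisfy \<open>A\<^sup>2 = 16 A(q\<^sup>2) \<phi>(q\<^sup>2)\<^sup>4\<close>, so their
  quotient \<open>r\<close> satisfies \<open>r\<^sup>2 = r(q\<^sup>2)\<close>.
\<close>

lemma theta_fourth_powers:
  "(theta ^ 4 - (theta oo - fps_X) ^ 4) * (euler oo fps_X ^ 2) ^ 4 =
    16 * fps_X * (euler oo fps_X ^ 4) ^ 8"
proof -
  define e2 e4 e8 where "e2 = euler oo fps_X ^ 2" "e4 = euler oo fps_X ^ 4"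
    "e8 = euler oo fps_X ^ 8"
  note defs = this
  define p m p2 m2 where "p = theta" "m = theta oo - fps_X" "p2 = theta oo fps_X ^ 2"
    "m2 = (theta oo - fps_X) oo fps_X ^ 2"
  note thetas = this
  define A where "A = p ^ 4 - m ^ 4"
  define A2 where "A2 = A oo fps_X ^ 2"
  have A2: "A2 = p2 ^ 4 - m2 ^ 4"
    unfolding A2_def A_def thetas by (simp add: fps_compose_sub_distrib fps_compose_power)
  have nz: "e2 \<noteq> 0" "e4 \<noteq> 0" "e8 \<noteq> 0"
    unfolding defs by (auto simp: fps_compose_eq_0_iff dest: arg_cong[of _ _ "\<lambda>f. f $ 0"])
  have d: "e2 oo fps_X ^ 2 = e4" "e4 oo fps_X ^ 2 = e8"
    by (simp_all add: defs fps_compose_X_power_X_power)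
  have g: "e2 * m = euler ^ 2"
    unfolding defs thetas by (rule gauss_theta)
  have "(e2 * m) oo fps_X ^ 2 = euler ^ 2 oo fps_X ^ 2"
    unfolding g ..
  then have g2: "e4 * m2 = e2 ^ 2"
    by (simp add: fps_compose_mult_distrib d) (simp add: defs thetas fps_compose_power)
  have "p * m * e4 ^ 2 = e2 ^ 4"
    unfolding thetas defs by (rule theta_mult)
  then have "p * m * e4 ^ 2 = m2 ^ 2 * e4 ^ 2"
    using g2 by algebra
  then have pm: "p * m = m2 ^ 2"
    using nz by simp
  have sum: "p ^ 2 + m ^ 2 = 2 * p2 ^ 2"
    using theta_square_minus unfolding thetas by (simp add: fps_compose_power)
  \<comment> \<open>A = (p^2 - m^2)(p^2 + m^2), and (p^2 - m^2)^2 = (p^2 + m^2)^2 - 4 (pm)^2 = 4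
    (p2^4 - m2^4) = 4 A2.\<close>
  have A_eq: "A ^ 2 = 16 * A2 * p2 ^ 4"
    unfolding A_def A2 using pm sum by algebra
  have "(theta * euler ^ 2 * e4 ^ 2) oo fps_X ^ 2 = (e2 ^ 5) oo fps_X ^ 2"
    using theta_euler unfolding defs by simp
  then have p2: "p2 * e2 ^ 2 * e8 ^ 2 = e4 ^ 5"
    by (simp add: fps_compose_mult_distrib d flip: fps_compose_power) (simp add: defs thetas)
  \<comment> \<open>\<open>r\<close> is the quotient of the two sides of the claim. The factor q is
    removed from \<open>A\<close> first, so that the remaining denominator has nonzero constant
    term.\<close>
  define a where "a = fps_shift 1 A"
  define r where "r = a * e2 ^ 4 * inverse (16 * e4 ^ 8)"
  define r2 where "r2 = r oo fps_X ^ 2"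
  have A0: "A $ 0 = 0" and A1: "A $ 1 = 16"
  proof -
    have "theta $ 0 = 1" "theta $ 1 = 2"
      unfolding theta_def card_square_roots by (auto intro: exI[of _ 1])
    moreover from this have "m $ 0 = 1" "m $ 1 = - 2"
      unfolding thetas by (simp_all add: fps_compose_uminus')
    ultimately show "A $ 0 = 0" "A $ 1 = 16"
      unfolding A_def thetas(1) by (simp_all add: eval_nat_numeral fps_mult_nth)
  qed
  have A: "A = fps_X * a"
    unfolding a_def using A0 by (intro fps_ext) (auto simp: gr0_conv_Suc)
  have a0: "a $ 0 = 16" using A1 by (simp add: a_def)
  have "16 * e4 ^ 8 * r = a * e2 ^ 4"
  proof -
    have "(16 * e4 ^ 8) * inverse (16 * e4 ^ 8) = 1"
      by (rule inverse_mult_eq_1') (simp add: defs numeral_fps_const fps_nth_power_0)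
    then show ?thesis unfolding r_def by algebra
  qed
  then have r: "16 * fps_X * e4 ^ 8 * r = A * e2 ^ 4"
    unfolding A by algebra
  have "(16 * fps_X * e4 ^ 8 * r) oo fps_X ^ 2 = (A * e2 ^ 4) oo fps_X ^ 2"
    unfolding r ..
  then have r2: "16 * fps_X ^ 2 * e8 ^ 8 * r2 = A2 * e4 ^ 4"
    by (simp add: fps_compose_mult_distrib d numeral_fps_const fps_X_power_compose A2_def r2_def
        flip: fps_compose_power)
  \<comment> \<open>\<open>Z\<close> clears the denominators of \<open>r ^ 2\<close> and
    \<open>r2\<close>; its last two factors supply what is missing in order to apply
    \<open>p2\<close> and \<open>r2\<close>.\<close>
  define Z where "Z = 256 * fps_X ^ 2 * e4 ^ 16 * e8 ^ 8 * e4 ^ 4"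
  have "Z * r ^ 2 = Z * r2"
  proof -
    have "256 * fps_X ^ 2 * e4 ^ 16 * r ^ 2 = A ^ 2 * e2 ^ 8"
      using r by algebra
    then have "Z * r ^ 2 = 16 * (p2 * e2 ^ 2 * e8 ^ 2) ^ 4 * (A2 * e4 ^ 4)"
      unfolding Z_def A_eq by algebra
    also have "\<dots> = 256 * e4 ^ 20 * fps_X ^ 2 * e8 ^ 8 * r2"
      unfolding p2 r2[symmetric] by algebra
    also have "\<dots> = Z * r2"
      unfolding Z_def by algebra
    finally show ?thesis .
  qed
  moreover have "Z \<noteq> 0" unfolding Z_def using nz by simp
  ultimately have "r ^ 2 = r oo fps_X ^ 2"
    unfolding r2_def by simp
  moreover have "r $ 0 = 1"
    by (simp add: r_def a0 defs fps_nth_power_0 numeral_fps_const)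
  ultimately have "r = 1"
    by (rule fps_square_eq_dilation)
  then show ?thesis
    using r unfolding A_def thetas defs by simp
qed

text \<open>Jacobi's identity with both theta values replaced by Euler products. Divided by
  \<open>(euler oo fps_X ^ 2) ^ 24\<close> it becomes the formula for 1 - x.\<close>

lemma euler_power_identity:
  "(euler oo fps_X ^ 2) ^ 24 - euler ^ 16 * (euler oo fps_X ^ 4) ^ 8 =
    16 * fps_X * euler ^ 8 * (euler oo fps_X ^ 4) ^ 16"
proof -
  define e e2 e4 where "e = euler" "e2 = euler oo fps_X ^ 2" "e4 = euler oo fps_X ^ 4"
  note defs = this
  define p m where "p = theta" "m = theta oo - fps_X"
  have "(p * e ^ 2 * e4 ^ 2) ^ 4 = (e2 ^ 5) ^ 4"
    using theta_euler unfolding defs p_m_def by simp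
  then have 1: "p ^ 4 * e ^ 8 * e4 ^ 8 = e2 ^ 20"
    by (simp add: power_mult_distrib flip: power_mult)
  have "(e2 * m) ^ 4 = (e ^ 2) ^ 4"
    using gauss_theta unfolding defs p_m_def by simp
  then have 2: "m ^ 4 * e2 ^ 4 = e ^ 8"
    by (simp add: power_mult_distrib mult.commute flip: power_mult)
  have 3: "(p ^ 4 - m ^ 4) * e2 ^ 4 = 16 * fps_X * e4 ^ 8"
    using theta_fourth_powers unfolding defs p_m_def .
  have "e2 ^ 24 - e ^ 16 * e4 ^ 8 = e2 ^ 20 * e2 ^ 4 - e ^ 8 * e ^ 8 * e4 ^ 8"
    by (simp flip: power_add)
  also have "\<dots> = (p ^ 4 - m ^ 4) * e2 ^ 4 * e ^ 8 * e4 ^ 8"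
    unfolding 1[symmetric] 2[symmetric] by algebra
  also have "\<dots> = 16 * fps_X * e ^ 8 * (e4 ^ 8 * e4 ^ 8)"
    unfolding 3 by (simp only: mult_ac)
  also have "e4 ^ 8 * e4 ^ 8 = e4 ^ 16" by (simp flip: power_add)
  finally show ?thesis unfolding defs .
qed

section \<open>The Hauptmodul and its modular equation\<close>

text \<open>Eliminating x: squaring the first relation and comparing with the second gives t2 = x^3
  t^2, after which the claim is t^2 times a polynomial identity in x and t.\<close>

lemma modular_equation_algebra:
  fixes t t2 x :: "'a::{idom,semiring_char_0}"
  assumes "16 * t * x ^ 2 = 1 - x" "256 * x * t2 = (1 - x) ^ 2" "x \<noteq> 0"
  shows "t ^ 2 = (48 * t2 + 4096 * t2 ^ 2) * t + t2"
proof -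
  have "256 * x * t2 = 256 * x * (x ^ 3 * t ^ 2)"
    using assms(1,2) by algebra
  then have t2: "t2 = x ^ 3 * t ^ 2"
    using assms(3) by simp
  \<comment> \<open>The cube of x + 16 t x^2 = 1, with two of its terms merged by the same
    relation.\<close>
  have "48 * x ^ 3 * t + 4096 * x ^ 6 * t ^ 3 + x ^ 3 = 1"
    using assms(1) by algebra
  then show ?thesis
    unfolding t2 by algebra
qed

text \<open>Here \<open>dx\<close>, \<open>dt\<close> and \<open>2 * dt2\<close> play the roles of q
  d/dq of x, t and t2 = t(q^2), the 2 coming from the chain rule. Both \<open>dt\<close> and
  \<open>dt2\<close> are proportional to \<open>dx\<close>, which is eliminated.\<close>

lemma derivative_algebra:
  fixes t t2 x dx dt dt2 :: "'a::{idom,semiring_char_0}"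
  assumes "16 * t * x ^ 2 = 1 - x" "256 * x * t2 = (1 - x) ^ 2" "x \<noteq> 0"
    and "16 * (dt * x ^ 2 + t * (2 * x * dx)) = - dx"
    and "256 * (dx * t2 + x * (2 * dt2)) = - (2 * (1 - x) * dx)"
  shows "x * dt * (1 - x ^ 2) = 32 * dt2 * (2 - x)"
proof -
  have "16 * x ^ 3 * dt = - dx * (2 - x)"
    using assms(1,4) by algebra
  moreover have "512 * x ^ 2 * dt2 = - dx * ((1 - x) * (1 + x))"
    using assms(2,5) by algebra
  ultimately have "16 * x ^ 2 * (x * dt * (1 - x ^ 2)) = 16 * x ^ 2 * (32 * dt2 * (2 - x))"
    by algebra
  moreover have "16 * x ^ 2 \<noteq> 0" using assms(3) by simp
  ultimately show ?thesis by (meson mult_left_cancel)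
qed

text \<open>Here \<open>y\<close>, \<open>W'\<close>, \<open>t'\<close> are \<open>x\<close>, \<open>W\<close>, \<open>t\<close> at \<open>-q\<close>, and \<open>W2\<close>, \<open>t2\<close> are \<open>W\<close>, \<open>t\<close> at \<open>q\<^sup>2\<close>.\<close>

lemma trace_algebra:
  fixes x y W W' W2 t t' t2 :: "'a::{idom,semiring_char_0}"
  assumes "x * y = 1" "x ^ 2 \<noteq> 1"
    and "16 * t * x ^ 2 = 1 - x" "16 * t' * y ^ 2 = 1 - y" "256 * x * t2 = (1 - x) ^ 2"
    and W: "W * (1 - x ^ 2) = 32 * (2 - x) * W2" and W': "W' * (1 - y ^ 2) = 32 * (2 - y) * W2"
  shows "W + W' = 2 * (32 * W2)"
    and "W * t + W' * t' = 2 * ((1 + 1280 * t2 + 131072 * t2 ^ 2) * W2)"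
proof -
  have x: "x \<noteq> 0" and d: "1 - x ^ 2 \<noteq> 0" using assms(1,2) by auto
  \<comment> \<open>Substituting y = 1/x puts \<open>W'\<close> over the same denominator 1 - x^2 as
    \<open>W\<close>.\<close>
  have V: "W' * (1 - x ^ 2) = 32 * (x - 2 * x ^ 2) * W2"
    using W' assms(1) by algebra
  have "(W + W') * (1 - x ^ 2) = 2 * (32 * W2) * (1 - x ^ 2)"
    using W V by algebra
  then show "W + W' = 2 * (32 * W2)" using d by simp
  have t': "16 * t' = x ^ 2 - x"
    using assms(1,4) by algebra
  \<comment> \<open>The quartic is what the trace of \<open>W * t\<close> leaves after division by 1
    - x^2. It is palindromic, so x^(-2) times it is a polynomial in x + 1/x = 256 t2 + 2.\<close>
  have r: "128 * x ^ 2 * (1 + 1280 * t2 + 131072 * t2 ^ 2) =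
      128 * (2 * x ^ 4 - 3 * x ^ 3 + 3 * x ^ 2 - 3 * x + 2)"
    using assms(5) by algebra
  have "128 * x ^ 2 * (W * t + W' * t') * (1 - x ^ 2) =
      256 * (2 * x ^ 4 - 3 * x ^ 3 + 3 * x ^ 2 - 3 * x + 2) * W2 * (1 - x ^ 2)"
  proof -
    have "128 * x ^ 2 * (W * t + W' * t') * (1 - x ^ 2) =
        8 * (16 * t * x ^ 2) * (W * (1 - x ^ 2)) + 8 * x ^ 2 * (16 * t') * (W' * (1 - x ^ 2))"
      by algebra
    also have "\<dots> = 8 * (1 - x) * (32 * (2 - x) * W2) + 8 * x ^ 2 * (x ^ 2 - x) * (32 * (x - 2 * x ^ 2) * W2)"
      unfolding W V t' assms(3) ..
    finally show ?thesis by algebra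
  qed
  also have "\<dots> = 2 * (128 * x ^ 2 * (1 + 1280 * t2 + 131072 * t2 ^ 2)) * W2 * (1 - x ^ 2)"
    unfolding r by algebra
  finally have "(128 * x ^ 2 * (1 - x ^ 2)) * (W * t + W' * t') =
      (128 * x ^ 2 * (1 - x ^ 2)) * (2 * ((1 + 1280 * t2 + 131072 * t2 ^ 2) * W2))"
    by algebra
  moreover have "128 * x ^ 2 * (1 - x ^ 2) \<noteq> 0" using x d by simp
  ultimately show "W * t + W' * t' = 2 * ((1 + 1280 * t2 + 131072 * t2 ^ 2) * W2)"
    by (meson mult_left_cancel)
qed

lemma fps_XD_numeral: "fps_XD (numeral k :: 'a::comm_ring_1 fps) = 0"
  by (simp add: fps_XD_def)

lemma fps_XD_diff: "fps_XD (a - b) = fps_XD a - fps_XD (b :: 'a::comm_ring_1 fps)"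
  by (simp add: fps_XD_def algebra_simps)

text \<open>The eta quotient t in the variable q: of the fractional powers of q in the eta factors a
  single q remains.\<close>

definition hauptmodul :: "rat fps" where
  "hauptmodul = fps_X * ((euler oo fps_X ^ 2) * inverse euler) ^ 24"

text \<open>The eta quotient H, whose fractional powers of q cancel. By \<open>gauss_theta\<close>
  it equals \<phi>(-q)^2.\<close>

definition theta_weight1 :: "rat fps" where
  "theta_weight1 = euler ^ 4 * inverse (euler oo fps_X ^ 2) ^ 2"

text \<open>The factor on the right is 2 E_2(q^2) - E_2(q), that is J: its 1 comes from the factor q
  of t, its divisor sums from the two Euler products.\<close>

lemma fps_XD_hauptmodul:
  "fps_XD hauptmodul = hauptmodul * (1 + 24 * sigma_series - 48 * (sigma_series oo fps_X ^ 2))"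
proof -
  define e e2 i S S2 where "e = euler" "e2 = euler oo fps_X ^ 2" "i = inverse euler"
    "S = sigma_series" "S2 = sigma_series oo fps_X ^ 2"
  note defs = this
  have i: "e * i = 1" unfolding defs by (rule inverse_mult_eq_1') simp
  have e: "fps_XD e = - (S * e)" unfolding defs by (rule fps_XD_euler)
  have "fps_XD e2 = of_nat 2 * (fps_XD euler oo fps_X ^ 2)"
    unfolding defs by (rule fps_XD_compose_X_power) simp
  then have e2: "fps_XD e2 = - (2 * S2 * e2)"
    unfolding fps_XD_euler by (simp add: fps_compose_mult_distrib fps_compose_uminus defs)
  have "fps_XD (e * i) = 0" unfolding i by (simp add: fps_XD_def)
  then have "e * fps_XD i = S * (e * i)"
    unfolding fps_XD_mult e by algebra
  then have "fps_XD i = S * i" using i by algebra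
  then have w: "fps_XD (e2 * i) = (S - 2 * S2) * (e2 * i)"
    unfolding fps_XD_mult e2 by algebra
  have "fps_XD hauptmodul = fps_X * (e2 * i) ^ 24 +
      fps_X * (24 * (e2 * i) ^ 23 * ((S - 2 * S2) * (e2 * i)))"
    unfolding hauptmodul_def defs(2,3)[symmetric] fps_XD_mult[of fps_X] fps_XD_power w
    by (simp add: fps_XD_def)
  also have "\<dots> = hauptmodul * (1 + 24 * S - 48 * S2)"
    unfolding hauptmodul_def defs(2,3)[symmetric] by algebra
  finally show ?thesis unfolding defs .
qed

lemma U2_hauptmodul:
  fixes t W :: "rat fps"
  defines "t \<equiv> hauptmodul"
  defines "W \<equiv> theta_weight1 ^ 4 * fps_XD t"
  shows hauptmodul_modular_equation:
      "t ^ 2 = (48 * (t oo fps_X ^ 2) + 4096 * (t oo fps_X ^ 2) ^ 2) * t + (t oo fps_X ^ 2)"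
    and U2_W: "U2 W = 32 * W"
    and U2_Wt: "U2 (W * t) = (1 + 1280 * t + 131072 * t ^ 2) * W"
proof -
  define e e2 e4 i i2 i4 m where "e = euler" "e2 = euler oo fps_X ^ 2" "e4 = euler oo fps_X ^ 4"
    "i = inverse euler" "i2 = inverse (euler oo fps_X ^ 2)" "i4 = inverse (euler oo fps_X ^ 4)"
    "m = euler oo - fps_X"
  note defs = this
  have inv: "e * i = 1" "e2 * i2 = 1" "e4 * i4 = 1"
    unfolding defs by (intro inverse_mult_eq_1'; simp)+
  have nz: "e2 \<noteq> 0" "e \<noteq> 0" "e4 \<noteq> 0" using inv by auto
  have comp2: "e oo fps_X ^ 2 = e2" "e2 oo fps_X ^ 2 = e4"
    by (simp_all add: defs fps_compose_X_power_X_power)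
  have icomp2: "i oo fps_X ^ 2 = i2" "i2 oo fps_X ^ 2 = i4"
    unfolding defs by (simp_all add: fps_inverse_compose fps_compose_X_power_X_power)
  have compm: "e oo - fps_X = m" "e4 oo - fps_X = e4" "i2 oo - fps_X = i2"
    unfolding defs by (simp_all add: fps_inverse_compose fps_compose_X_power_minus_X)
  \<comment> \<open>\<open>x\<close> is the quotient \<phi>(-q)^4 / \<phi>(q)^4 in Euler products.
    \<open>h2\<close> turns out to be H^4 at q^2.\<close>
  define x h2 t2 y where "x = e ^ 16 * e4 ^ 8 * i2 ^ 24" "h2 = e2 ^ 16 * i4 ^ 8"
    "t2 = t oo fps_X ^ 2" "y = x oo - fps_X"
  note defs' = this
  have t: "t = fps_X * e2 ^ 24 * i ^ 24"
    unfolding t_def hauptmodul_def defs by (simp add: power_mult_distrib)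
  have t2: "t2 = fps_X ^ 2 * e4 ^ 24 * i2 ^ 24"
    unfolding defs' t by (simp add: fps_compose_mult_distrib comp2 icomp2 fps_X_power_compose
        flip: fps_compose_power)
  have y: "y = m ^ 16 * e4 ^ 8 * i2 ^ 24"
    unfolding defs' by (simp add: fps_compose_mult_distrib compm flip: fps_compose_power)
  have H4: "theta_weight1 ^ 4 = e ^ 16 * i2 ^ 8"
    unfolding theta_weight1_def defs by (simp add: power_mult_distrib flip: power_mult)
  have cancel: "e ^ k * i ^ k = 1" "e2 ^ k * i2 ^ k = 1" "e4 ^ k * i4 ^ k = 1" for k
    by (simp_all add: inv flip: power_mult_distrib)
  have key: "e2 ^ 24 - e ^ 16 * e4 ^ 8 = 16 * fps_X * e ^ 8 * e4 ^ 16"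
    unfolding defs by (rule euler_power_identity)
  have "1 - x = (e2 ^ 24 - e ^ 16 * e4 ^ 8) * i2 ^ 24"
    unfolding defs' using cancel(2)[of 24] by algebra
  then have x1: "1 - x = 16 * fps_X * e ^ 8 * e4 ^ 16 * i2 ^ 24"
    unfolding key .
  have X1: "16 * t * x ^ 2 = 1 - x"
  proof -
    have "16 * t * x ^ 2 = 16 * fps_X * e ^ 8 * e4 ^ 16 * i2 ^ 24 * (e ^ 24 * i ^ 24) * (e2 ^ 24 * i2 ^ 24)"
      unfolding t defs' by algebra
    then show ?thesis unfolding cancel x1 by simp
  qed
  have X2: "256 * x * t2 = (1 - x) ^ 2"
    unfolding x1 t2 unfolding defs' by algebra
  have X3: "theta_weight1 ^ 4 = x * h2"
  proof -
    have "x * h2 = e ^ 16 * i2 ^ 8 * (e2 ^ 16 * i2 ^ 16) * (e4 ^ 8 * i4 ^ 8)"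
      unfolding defs' by algebra
    then show ?thesis unfolding cancel H4 by simp
  qed
  have X4: "x * y = 1"
  proof -
    have "e * m * e4 = e2 ^ 3" unfolding defs by (rule euler_minus)
    moreover have "x * y = (e * m * e4) ^ 16 * i2 ^ 48"
      unfolding y unfolding defs' by algebra
    ultimately have "x * y = e2 ^ 48 * i2 ^ 48"
      by (simp flip: power_mult)
    then show ?thesis unfolding cancel .
  qed
  have h2: "theta_weight1 ^ 4 oo fps_X ^ 2 = h2"
    unfolding H4 defs' by (simp add: fps_compose_mult_distrib comp2 icomp2 flip: fps_compose_power)
  have x_nz: "x \<noteq> 0" using X4 by auto
  \<comment> \<open>Needed in \<open>trace_algebra\<close>, where 1 - x^2 is cancelled.\<close>
  have "1 - x \<noteq> 0" "1 + x \<noteq> 0"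
  proof -
    have "i2 \<noteq> 0" using inv by auto
    then show "1 - x \<noteq> 0" unfolding x1 using nz by simp
    have "x $ 0 = 1" by (simp add: defs' defs fps_nth_power_0)
    then have "(1 + x) $ 0 = 2" by simp
    then show "1 + x \<noteq> 0" by (metis fps_zero_nth zero_neq_numeral)
  qed
  moreover have "1 - x ^ 2 = (1 - x) * (1 + x)" by algebra
  ultimately have x_sq: "x ^ 2 \<noteq> 1" by auto
  show "t ^ 2 = (48 * (t oo fps_X ^ 2) + 4096 * (t oo fps_X ^ 2) ^ 2) * t + (t oo fps_X ^ 2)"
    using modular_equation_algebra[OF X1 X2 x_nz] unfolding defs' .
  define dt dt2 dx where "dt = fps_XD t" "dt2 = fps_XD t oo fps_X ^ 2" "dx = fps_XD x"
  note ders = this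
  have dt2: "fps_XD t2 = 2 * dt2"
    unfolding defs' ders using fps_XD_compose_X_power[of 2 t] by simp
  have "fps_XD (16 * t * x ^ 2) = 16 * (dt * x ^ 2 + t * (2 * x * dx))"
    unfolding fps_XD_mult fps_XD_numeral fps_XD_power ders by (simp add: algebra_simps)
  moreover have "fps_XD (1 - x) = - dx"
    unfolding fps_XD_diff ders by (simp add: fps_XD_def)
  ultimately have D1: "16 * (dt * x ^ 2 + t * (2 * x * dx)) = - dx"
    unfolding X1 by simp
  have "fps_XD (256 * x * t2) = 256 * (dx * t2 + x * (2 * dt2))"
    unfolding fps_XD_mult fps_XD_numeral dt2 ders by (simp add: algebra_simps)
  moreover have "fps_XD ((1 - x) ^ 2) = - (2 * (1 - x) * dx)"
    unfolding fps_XD_power \<open>fps_XD (1 - x) = - dx\<close> by simp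
  ultimately have D2: "256 * (dx * t2 + x * (2 * dt2)) = - (2 * (1 - x) * dx)"
    unfolding X2 by simp
  have "x * dt * (1 - x ^ 2) = 32 * dt2 * (2 - x)"
    by (rule derivative_algebra[OF X1 X2 x_nz D1 D2])
  moreover define W2 where "W2 = h2 * dt2"
  moreover have W: "W = x * h2 * dt" unfolding W_def X3 ders ..
  ultimately have WW: "W * (1 - x ^ 2) = 32 * (2 - x) * W2"
    by algebra
  have W2: "W oo fps_X ^ 2 = W2"
    unfolding W_def W2_def by (simp add: fps_compose_mult_distrib h2 ders)
  have "(W * (1 - x ^ 2)) oo - fps_X = (32 * (2 - x) * W2) oo - fps_X"
    unfolding WW ..
  \<comment> \<open>Under q -> -q the series \<open>W2\<close> in q^2 stays fixed while x becomes
    y.\<close>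
  then have WW': "(W oo - fps_X) * (1 - y ^ 2) = 32 * (2 - y) * W2"
    unfolding W2[symmetric] defs'(4)
    by (simp add: fps_compose_mult_distrib fps_compose_sub_distrib fps_compose_X_power_minus_X
        numeral_fps_const fps_compose_power)
  have "(16 * t * x ^ 2) oo - fps_X = (1 - x) oo - fps_X"
    unfolding X1 ..
  then have X1': "16 * (t oo - fps_X) * y ^ 2 = 1 - y"
    unfolding defs'(4) by (simp add: fps_compose_mult_distrib fps_compose_sub_distrib
        numeral_fps_const fps_compose_power)
  note trace = trace_algebra[OF X4 x_sq X1 X1' X2 WW WW']
  have "2 * (U2 W oo fps_X ^ 2) = 2 * (32 * W oo fps_X ^ 2)"
    using trace(1) unfolding fps_even_part W2[symmetric]
    by (simp add: fps_compose_mult_distrib numeral_fps_const)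
  then have "U2 W oo fps_X ^ 2 = 32 * W oo fps_X ^ 2" by simp
  then show "U2 W = 32 * W"
    by (rule fps_compose_X_power_inj) simp
  have "2 * (U2 (W * t) oo fps_X ^ 2) = W * t + (W * t oo - fps_X)"
    by (rule fps_even_part[symmetric])
  also have "W * t oo - fps_X = (W oo - fps_X) * (t oo - fps_X)"
    by (rule fps_compose_mult_distrib) simp
  also note trace(2)
  also have "1 + 1280 * t2 + 131072 * t2 ^ 2 = (1 + 1280 * t + 131072 * t ^ 2) oo fps_X ^ 2"
    unfolding defs'(3)
    by (simp add: fps_compose_mult_distrib fps_compose_add_distrib numeral_fps_const
        flip: fps_compose_power)
  also have "\<dots> * W2 = (1 + 1280 * t + 131072 * t ^ 2) * W oo fps_X ^ 2"
    unfolding W2[symmetric] by (rule fps_compose_mult_distrib[symmetric]) simp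
  finally have "U2 (W * t) oo fps_X ^ 2 = (1 + 1280 * t + 131072 * t ^ 2) * W oo fps_X ^ 2" by simp
  then show "U2 (W * t) = (1 + 1280 * t + 131072 * t ^ 2) * W"
    by (rule fps_compose_X_power_inj) simp
qed

section \<open>Integral coefficients\<close>

lemma fps_of_ints_nth [simp]: "fps_of_ints f $ n = of_int (f $ n)"
  by (simp add: fps_of_ints_def)

lemma fps_of_ints_add: "fps_of_ints (f + g) = fps_of_ints f + fps_of_ints g"
  by (rule fps_ext) simp

lemma fps_of_ints_diff: "fps_of_ints (f - g) = fps_of_ints f - fps_of_ints g"
  by (rule fps_ext) simp

lemma fps_of_ints_mult: "fps_of_ints (f * g) = fps_of_ints f * (fps_of_ints g :: 'a::comm_ring_1 fps)"
  by (rule fps_ext) (simp add: fps_mult_nth)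

lemma fps_of_ints_1 [simp]: "fps_of_ints 1 = 1"
  by (rule fps_ext) simp

lemma fps_of_ints_numeral [simp]: "fps_of_ints (numeral k) = numeral k"
  by (rule fps_ext) (simp add: fps_numeral_nth)

lemma fps_of_ints_power: "fps_of_ints (f ^ n) = (fps_of_ints f :: 'a::comm_ring_1 fps) ^ n"
  by (induction n) (simp_all add: fps_of_ints_mult)

lemma fps_of_ints_compose_X_power:
  "k > 0 \<Longrightarrow> fps_of_ints (f oo fps_X ^ k) = (fps_of_ints f oo fps_X ^ k :: 'a::comm_ring_1 fps)"
  by (rule fps_ext) (simp add: fps_nth_compose_X_power)

lemma fps_of_ints_U2: "fps_of_ints (U2 f) = U2 (fps_of_ints f)"
  by (rule fps_ext) (simp add: U2_def)

lemma fps_of_ints_eq_iff: "fps_of_ints f = (fps_of_ints g :: 'a::ring_char_0 fps) \<longleftrightarrow> f = g"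
  by (auto simp: fps_eq_iff)

lemmas fps_of_ints_simps = fps_of_ints_add fps_of_ints_diff fps_of_ints_mult fps_of_ints_power
  fps_of_ints_compose_X_power fps_of_ints_U2

section \<open>The given eta quotients and E_2 in terms of Euler's product\<close>

lemma eta_eq: "eta = fps_X * (euler oo fps_X ^ 24)"
  unfolding eta_def prodinf_eq_euler ..

lemma eta_compose: "eta oo fps_X ^ 2 = fps_X ^ 2 * ((euler oo fps_X ^ 2) oo fps_X ^ 24)"
  unfolding eta_eq by (simp add: fps_compose_mult_distrib fps_compose_X_power_X_power)

text \<open>The substitution q = x^24 is injective, so identities between eta quotients in x descend
  to q.\<close>

lemma in_x_eqD: "in_x f = g oo fps_X ^ 24 \<Longrightarrow> fps_of_ints f = g"
  unfolding in_x_def by (erule fps_compose_X_power_inj) simp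

lemma fps_of_ints_hauptmodul:
  assumes "in_x t = ((eta oo fps_X ^ 2) / eta) ^ 24"
  shows "fps_of_ints t = hauptmodul"
proof (rule in_x_eqD)
  let ?e = "euler oo fps_X ^ 24" and ?e2 = "(euler oo fps_X ^ 2) oo fps_X ^ 24"
    and ?i = "inverse euler oo fps_X ^ 24"
  have i: "?e * ?i = 1"
    by (simp flip: fps_compose_mult_distrib add: inverse_mult_eq_1')
  have "eta \<noteq> 0"
    unfolding eta_eq by (auto simp: fps_compose_eq_0_iff dest: arg_cong[of euler _ "\<lambda>f. f $ 0"])
  \<comment> \<open>\<open>eta\<close> has no constant term and hence no inverse series; the
    quotient is found by exhibiting the numerator as a multiple of \<open>eta\<close>.\<close>
  moreover have "eta oo fps_X ^ 2 = fps_X * (?e2 * ?i) * eta"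
    unfolding eta_compose unfolding eta_eq using i by algebra
  ultimately have "(eta oo fps_X ^ 2) / eta = fps_X * (?e2 * ?i)" by simp
  then show "in_x t = hauptmodul oo fps_X ^ 24"
    unfolding assms hauptmodul_def
    by (simp add: fps_compose_mult_distrib power_mult_distrib flip: fps_compose_power)
qed

lemma fps_of_ints_theta_weight1:
  assumes "in_x H = eta ^ 4 / (eta oo fps_X ^ 2) ^ 2"
  shows "fps_of_ints H = theta_weight1"
proof (rule in_x_eqD)
  let ?e = "euler oo fps_X ^ 24" and ?e2 = "(euler oo fps_X ^ 2) oo fps_X ^ 24"
    and ?i2 = "inverse (euler oo fps_X ^ 2) oo fps_X ^ 24"
  have i: "?e2 * ?i2 = 1"
    by (simp flip: fps_compose_mult_distrib add: inverse_mult_eq_1')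
  have "eta oo fps_X ^ 2 \<noteq> 0"
    unfolding eta_compose by (auto simp: fps_compose_eq_0_iff dest: arg_cong[of euler _ "\<lambda>f. f $ 0"])
  moreover have "eta ^ 4 = ?e ^ 4 * ?i2 ^ 2 * (eta oo fps_X ^ 2) ^ 2"
    unfolding eta_compose unfolding eta_eq using i by algebra
  ultimately have "eta ^ 4 / (eta oo fps_X ^ 2) ^ 2 = ?e ^ 4 * ?i2 ^ 2" by simp
  then show "in_x H = theta_weight1 oo fps_X ^ 24"
    unfolding assms theta_weight1_def
    by (simp add: fps_compose_mult_distrib flip: fps_compose_power)
qed

lemma fps_of_ints_E2: "fps_of_ints E2 = 1 - 24 * sigma_series"
proof -
  have "(fps_of_ints E2 :: rat fps) = 1 - 24 *
      fps_of_ints (Abs_fps (\<lambda>n. if n = 0 then 0 else \<Sum>d | d dvd n. int d))"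
    unfolding E2_def fps_of_ints_diff fps_of_ints_mult fps_of_ints_1 fps_of_ints_numeral ..
  moreover have "fps_of_ints (Abs_fps (\<lambda>n. if n = 0 then 0 else \<Sum>d | d dvd n. int d)) = sigma_series"
    by (rule fps_ext) (simp add: sigma_series_def)
  ultimately show ?thesis by simp
qed

text \<open>
  With \<open>\<W> = \<T> t\<close> one has \<open>U\<^sub>2 (\<W> u\<^sup>n) = 32 \<W> R\<^sub>n(u)\<close> for \<open>R\<^sub>n = U2_poly n\<close>. The recurrence comes from
  the modular equation, rescaled by \<open>u = 64 t\<close>.
\<close>

fun U2_poly :: "nat \<Rightarrow> int fps" where
  "U2_poly 0 = 1"
| "U2_poly (Suc 0) = 2 * (1 + 20 * fps_X + 32 * fps_X ^ 2)"
| "U2_poly (Suc (Suc n)) =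
    (48 * fps_X + 64 * fps_X ^ 2) * U2_poly (Suc n) + 64 * fps_X * U2_poly n"

text \<open>Two steps of the recurrence gain at least one factor z, so R_n vanishes to order at
  least (n - 1)/2. This makes infinite combinations of the R_n converge coefficientwise.\<close>

lemma U2_poly_nth_eq_0: "2 * i + 1 < n \<Longrightarrow> U2_poly n $ i = 0"
proof (induction n arbitrary: i rule: U2_poly.induct)
  case (3 n)
  have "U2_poly (Suc (Suc n)) = fps_X * (fps_const 48 * U2_poly (Suc n)
      + fps_X * (fps_const 64 * U2_poly (Suc n)) + fps_const 64 * U2_poly n)"
    by (simp add: algebra_simps power2_eq_square numeral_fps_const)
  moreover have "U2_poly (Suc n) $ (i - 1) = 0" "U2_poly n $ (i - 1) = 0" if "i > 0"
    using that 3 by auto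
  moreover have "U2_poly (Suc n) $ (i - Suc (Suc 0)) = 0" if "i > 1"
    using that 3 by auto
  ultimately show ?case
    by (auto simp: fps_X_mult_nth simp del: U2_poly.simps)
qed auto

section \<open>The action of U_2 on series in u\<close>

lemma U2_add: "U2 (f + g) = U2 f + U2 g"
  by (rule fps_ext) (simp add: U2_def)

text \<open>U_2 is linear over series in q^2: at the index \<open>2 * n\<close> an odd
  \<open>i\<close> meets the odd index \<open>2 * n - i\<close>, where g(q^2) has coefficient
  0.\<close>

lemma U2_mult_dilation:
  fixes f g :: "'a::comm_ring_1 fps"
  shows "U2 (f * (g oo fps_X ^ 2)) = U2 f * g"
proof (rule fps_ext)
  fix n
  have "U2 (f * (g oo fps_X ^ 2)) $ n = (\<Sum>i=0..2*n. f $ i * (g oo fps_X ^ 2) $ (2 * n - i))"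
    by (simp add: U2_def fps_mult_nth)
  also have "\<dots> = (\<Sum>i\<in>(*) 2 ` {0..n}. f $ i * (g oo fps_X ^ 2) $ (2 * n - i))"
    by (rule sum.mono_neutral_right) (auto simp: fps_nth_compose_X_power elim!: evenE)
  also have "\<dots> = (\<Sum>i=0..n. f $ (2 * i) * (g oo fps_X ^ 2) $ (2 * n - 2 * i))"
    by (subst sum.reindex) (auto simp: inj_on_def)
  also have "\<dots> = (U2 f * g) $ n"
    by (simp add: fps_nth_compose_X_power U2_def fps_mult_nth flip: right_diff_distrib')
  finally show "U2 (f * (g oo fps_X ^ 2)) $ n = (U2 f * g) $ n" .
qed

text \<open>The modular equation is quadratic in u with coefficients in q^2, and these pass through
  U_2. So the images of \<open>W * u ^ n\<close> obey the recurrence that defines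
  \<open>U2_poly\<close>.\<close>

lemma U2_mult_power:
  fixes W t u :: "int fps"
  assumes "t $ 0 = 0" "u = 64 * t"
    and modular: "t ^ 2 = (48 * (t oo fps_X ^ 2) + 4096 * (t oo fps_X ^ 2) ^ 2) * t + (t oo fps_X ^ 2)"
    and W: "U2 W = 32 * W" and Wt: "U2 (W * t) = (1 + 1280 * t + 131072 * t ^ 2) * W"
  shows "U2 (W * u ^ n) = 32 * (W * (U2_poly n oo u))"
proof -
  have u0: "u $ 0 = 0" using assms(1,2) by (simp add: numeral_fps_const)
  define u2 where "u2 = u oo fps_X ^ 2"
  have "u2 = 64 * (t oo fps_X ^ 2)"
    unfolding u2_def assms(2) by (simp add: fps_compose_mult_distrib numeral_fps_const)
  then have sq: "u ^ 2 = (48 * u2 + 64 * u2 ^ 2) * u + 64 * u2"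
    using modular unfolding assms(2) by algebra
  have pow: "u2 ^ 2 = u ^ 2 oo fps_X ^ 2"
    unfolding u2_def by (rule fps_compose_power) simp
  show ?thesis
  proof (induction n rule: U2_poly.induct)
    case 1
    then show ?case by (simp add: W)
  next
    case 2
    \<comment> \<open>The constant 64 is written as a series in q^2 so that
      \<open>U2_mult_dilation\<close> can extract it.\<close>
    have "U2 (W * u) = U2 (W * t * (64 oo fps_X ^ 2))"
      by (simp add: assms(2) numeral_fps_const mult_ac)
    also have "\<dots> = U2 (W * t) * 64"
      by (rule U2_mult_dilation)
    also have "\<dots> = 32 * (W * (2 * (1 + 20 * u + 32 * u ^ 2)))"
      unfolding Wt assms(2) by algebra
    also have "2 * (1 + 20 * u + 32 * u ^ 2) = U2_poly (Suc 0) oo u"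
      using u0 by (simp add: fps_compose_mult_distrib fps_compose_add_distrib numeral_fps_const
          fps_X_power_compose)
    finally show ?case by simp
  next
    case (3 n)
    have "W * u ^ Suc (Suc n) = W * u ^ n * u ^ 2"
      by (simp add: power2_eq_square mult_ac)
    also have "\<dots> = (W * u ^ Suc n) * (48 * u2 + 64 * u2 ^ 2) + (W * u ^ n) * (64 * u2)"
      unfolding sq by (simp add: algebra_simps)
    also have "48 * u2 + 64 * u2 ^ 2 = (48 * u + 64 * u ^ 2) oo fps_X ^ 2"
      unfolding pow unfolding u2_def
      by (simp add: fps_compose_mult_distrib fps_compose_add_distrib numeral_fps_const)
    also have "64 * u2 = (64 * u) oo fps_X ^ 2"
      unfolding u2_def by (simp add: fps_compose_mult_distrib numeral_fps_const)
    finally have "U2 (W * u ^ Suc (Suc n)) =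
        U2 (W * u ^ Suc n) * (48 * u + 64 * u ^ 2) + U2 (W * u ^ n) * (64 * u)"
      by (simp only: U2_add U2_mult_dilation)
    also have "\<dots> = 32 * (W * ((48 * u + 64 * u ^ 2) * (U2_poly (Suc n) oo u) + 64 * u * (U2_poly n oo u)))"
      unfolding 3 by (simp add: algebra_simps)
    also have "(48 * u + 64 * u ^ 2) * (U2_poly (Suc n) oo u) + 64 * u * (U2_poly n oo u) =
        U2_poly (Suc (Suc n)) oo u"
      using u0 by (simp add: fps_compose_mult_distrib fps_compose_add_distrib numeral_fps_const
          fps_X_power_compose)
    finally show ?case .
  qed
qed

text \<open>Any truncation order \<open>N \<ge> m\<close> is allowed, so that coefficients of
  different index can be summed over a common range.\<close>

lemma fps_mult_compose_nth:
  fixes A f u :: "'a::comm_ring_1 fps"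
  assumes "\<And>n k. k < n \<Longrightarrow> (u ^ n) $ k = 0" "m \<le> N"
  shows "(A * (f oo u)) $ m = (\<Sum>n\<le>N. f $ n * (A * u ^ n) $ m)"
proof -
  have "(f oo u) $ k = (\<Sum>n\<le>N. f $ n * (u ^ n) $ k)" if "k \<le> m" for k
    unfolding fps_compose_nth using assms that by (intro sum.mono_neutral_left) auto
  then have "(A * (f oo u)) $ m = (\<Sum>k=0..m. \<Sum>n\<le>N. A $ k * (f $ n * (u ^ n) $ (m - k)))"
    by (simp add: fps_mult_nth sum_distrib_left)
  also have "\<dots> = (\<Sum>n\<le>N. \<Sum>k=0..m. A $ k * (f $ n * (u ^ n) $ (m - k)))"
    by (rule sum.swap)
  also have "\<dots> = (\<Sum>n\<le>N. f $ n * (A * u ^ n) $ m)"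
    by (simp add: fps_mult_nth sum_distrib_left mult_ac)
  finally show ?thesis .
qed

text \<open>Formally g is the sum of all f_n R_n. The infinite sum is treated coefficient by
  coefficient: by \<open>U2_poly_nth_eq_0\<close> only \<open>n \<le> 2 * i + 1\<close> contributes
  to coefficient \<open>i\<close> of g.\<close>

lemma U2_fps_of_ints_compose:
  fixes W u :: "int fps" and f :: "'a::comm_ring_1 fps"
  assumes u0: "u $ 0 = 0" and U2: "\<And>n. U2 (W * u ^ n) = 32 * (W * (U2_poly n oo u))"
  defines "g \<equiv> Abs_fps (\<lambda>i. \<Sum>n\<le>2*i+1. f $ n * of_int (U2_poly n $ i))"
  shows "U2 (fps_of_ints W * (f oo fps_of_ints u)) =
    2 ^ 5 * (fps_of_ints W * (g oo fps_of_ints u))"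
proof (rule fps_ext)
  fix m :: nat
  have vanish: "(u ^ n) $ k = 0" if "k < n" for n k
    using that u0 by (simp add: startsby_zero_power_prefix)
  then have vanish': "((fps_of_ints u :: 'a fps) ^ n) $ k = 0" if "k < n" for n k
    using that by (simp flip: fps_of_ints_power)
  \<comment> \<open>Large enough both for coefficient \<open>2 * m\<close> on the left and for the
    ranges \<open>n \<le> 2 * i + 1\<close>, \<open>i \<le> m\<close>, in \<open>g\<close>.\<close>
  define N where "N = 2 * m + 1"
  have nth: "(fps_of_ints W * fps_of_ints u ^ n :: 'a fps) $ k = of_int ((W * u ^ n) $ k)" for n k
    by (simp flip: fps_of_ints_power fps_of_ints_mult)
  have "(W * u ^ n) $ (2 * m) = 32 * (\<Sum>i\<le>m. U2_poly n $ i * (W * u ^ i) $ m)" for n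
  proof -
    have "(W * u ^ n) $ (2 * m) = (U2 (W * u ^ n)) $ m"
      by (simp add: U2_def)
    also have "\<dots> = 32 * (W * (U2_poly n oo u)) $ m"
      unfolding U2 by (simp add: numeral_fps_const)
    finally show ?thesis
      using vanish by (simp add: fps_mult_compose_nth[of u m m])
  qed
  then have "U2 (fps_of_ints W * (f oo fps_of_ints u)) $ m =
      (\<Sum>n\<le>N. f $ n * of_int (32 * (\<Sum>i\<le>m. U2_poly n $ i * (W * u ^ i) $ m)))"
    unfolding U2_def fps_nth_Abs_fps by (subst fps_mult_compose_nth[OF vanish', where N = N])
      (simp_all only: nth, simp add: N_def)
  also have "\<dots> = 32 * (\<Sum>n\<le>N. \<Sum>i\<le>m. f $ n * of_int (U2_poly n $ i) * of_int ((W * u ^ i) $ m))"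
    by (simp add: sum_distrib_left mult_ac)
  also have "\<dots> = 32 * (\<Sum>i\<le>m. \<Sum>n\<le>N. f $ n * of_int (U2_poly n $ i) * of_int ((W * u ^ i) $ m))"
    by (subst sum.swap) (rule refl)
  also have "\<dots> = 32 * (\<Sum>i\<le>m. g $ i * of_int ((W * u ^ i) $ m))"
  proof -
    have "(\<Sum>n\<le>N. f $ n * of_int (U2_poly n $ i)) = g $ i" if "i \<le> m" for i
      unfolding g_def fps_nth_Abs_fps
      using that by (intro sum.mono_neutral_right) (auto simp: N_def U2_poly_nth_eq_0)
    then show ?thesis by (simp flip: sum_distrib_right)
  qed
  also have "\<dots> = 32 * (fps_of_ints W * (g oo fps_of_ints u)) $ m"
    using fps_mult_compose_nth[OF vanish', of m m] by (simp add: nth)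
  also have "\<dots> = (2 ^ 5 * (fps_of_ints W * (g oo fps_of_ints u))) $ m"
    by (simp add: numeral_fps_const)
  finally show "U2 (fps_of_ints W * (f oo fps_of_ints u)) $ m =
    (2 ^ 5 * (fps_of_ints W * (g oo fps_of_ints u))) $ m" .
qed

text \<open>Each application of U_2 halves the index, splits off one factor \<open>a\<close> and
  stays in \<open>S\<close>, so it can be repeated \<open>r\<close> times.\<close>

lemma power_dvd_nth_of_U2_invariant:
  fixes S :: "'a::comm_ring_1 fps set"
  assumes "U2 ` S \<subseteq> (\<lambda>g. c * g) ` S" "c = fps_const a" "F \<in> S"
  shows "a ^ r dvd F $ (2 ^ r * m)"
  using assms(3)
proof (induction r arbitrary: F)
  case (Suc r)
  then obtain G where G: "G \<in> S" "U2 F = c * G" using assms(1) by blast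
  have "F $ (2 ^ Suc r * m) = U2 F $ (2 ^ r * m)"
    by (simp add: U2_def mult.assoc)
  also have "\<dots> = a * G $ (2 ^ r * m)"
    unfolding G(2) assms(2) by simp
  finally show ?case
    using Suc.IH[OF G(1)] by (simp add: mult_dvd_mono)
qed simp

theorem theorem7p1:
  fixes t H J u T :: "int fps"
  assumes t: "in_x t = ((eta oo fps_X ^ 2) / eta) ^ 24"
    and H: "in_x H = eta ^ 4 / (eta oo fps_X ^ 2) ^ 2"
    and J: "J = 2 * (E2 oo fps_X ^ 2) - E2"
    and u: "u = 64 * t"
    and T: "T = H ^ 4 * J"
  shows "U2 ` Z2_span (T * t) u \<subseteq> (\<lambda>g. 2 ^ 5 * g) ` Z2_span (T * t) u
    \<and> (\<forall>f :: Z2 fps.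
         let F = fps_of_ints (T * t) * (f oo fps_of_ints u)
         in \<forall>m r :: nat. 1 \<le> m \<longrightarrow> 1 \<le> r \<longrightarrow> enat (5 * r) \<le> v2 (F $ (2 ^ r * m)))"
proof -
  define W where "W = T * t"
  have th: "fps_of_ints t = hauptmodul" and Hh: "fps_of_ints H = theta_weight1"
    by (rule fps_of_ints_hauptmodul[OF t], rule fps_of_ints_theta_weight1[OF H])
  have "fps_of_ints J = 1 + 24 * sigma_series - 48 * (sigma_series oo fps_X ^ 2)"
    unfolding J by (simp add: fps_of_ints_simps fps_of_ints_E2 fps_compose_sub_distrib
        fps_compose_mult_distrib numeral_fps_const)
      (simp add: algebra_simps flip: numeral_fps_const)
  then have Wh: "fps_of_ints W = theta_weight1 ^ 4 * fps_XD hauptmodul"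
    unfolding W_def T fps_XD_hauptmodul by (simp add: fps_of_ints_simps th Hh mult_ac)
  \<comment> \<open>The identities over the rationals descend to integer series because the
    embedding of coefficients is injective.\<close>
  have modular: "t ^ 2 = (48 * (t oo fps_X ^ 2) + 4096 * (t oo fps_X ^ 2) ^ 2) * t + (t oo fps_X ^ 2)"
    using hauptmodul_modular_equation
    by (simp flip: fps_of_ints_eq_iff[where 'a = rat] add: fps_of_ints_simps th)
  have W: "U2 W = 32 * W"
    using U2_W by (simp flip: fps_of_ints_eq_iff[where 'a = rat] add: fps_of_ints_simps Wh)
  have Wt: "U2 (W * t) = (1 + 1280 * t + 131072 * t ^ 2) * W"
    using U2_Wt by (simp flip: fps_of_ints_eq_iff[where 'a = rat] add: fps_of_ints_simps Wh th)
  have "of_int (t $ 0) = hauptmodul $ 0"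
    unfolding th[symmetric] by simp
  then have t0: "t $ 0 = 0" by (simp add: hauptmodul_def)
  then have u0: "u $ 0 = 0" by (simp add: u numeral_fps_const)
  have incl: "U2 ` Z2_span W u \<subseteq> (\<lambda>g. 2 ^ 5 * g) ` Z2_span W u"
    unfolding Z2_span_def
    using U2_fps_of_ints_compose[OF u0 U2_mult_power[OF t0 u modular W Wt]] by blast
  have "enat (5 * r) \<le> v2 (F $ (2 ^ r * m))" if "F \<in> Z2_span W u" for F r m
  proof -
    have "(2 ^ 5) ^ r dvd F $ (2 ^ r * m)"
      by (rule power_dvd_nth_of_U2_invariant[OF incl _ that]) (simp add: numeral_fps_const)
    then show ?thesis
      unfolding v2_def power_mult[symmetric] by (intro SUP_upper) simp
  qed
  then show ?thesis
    using incl unfolding W_def Let_def Z2_span_def by blast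
qed

end
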